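(* Let $P\subset\mathbb{Z}$ be the set of (positive) primes, and let $C^*(P)\subset B(\ell^2(P))$ be the partial translation algebra arising from the inclusion of $P$ in $\mathbb{Z}$. The following are equivalent: (i) $C^*(P)$ is not isomorphic to the unitised compacts $\widetilde{\mathcal{K}}(\ell^2(P))$; (ii) de Polignac's conjecture holds for some even $n$, i.e. there is a positive even integer $n$ for which there exist infinitely many pairs of primes separated by distance $n$; (iii) the quotient of $C^*(P)$ by the compact operators $\mathcal{K}(\ell^2(P))$ is strictly larger than $\mathbb{C}$.
   Context: For $X\subseteq\mathbb{Z}$ and $n\in\mathbb{Z}$, the partial translation by $n$ on $X$ is the map $t_n$ with domain $\{x\in X: x+n\in X\}$ given by $t_n(x)=x+n$, regarded as the partial isometry of $\ell^2(X)$ sending $\delta_x$ to $\delta_{x+n}$ if $x+n\in X$ and to $0$ otherwise. The partial translation algebra $C^*(X)\subset B(\ell^2(X))$ arising from the inclusion $X\subset\mathbb{Z}$ is the $C^*$-algebra generated by all the operators $t_n$, $n\in\mathbb{Z}$. $\mathcal{K}(\ell^2(X))$ denotes the compact operators on $\ell^2(X)$, and $\widetilde{\mathcal{K}}(\ell^2(X))=\mathcal{K}(\ell^2(X))+\mathbb{C}1$ its unitisation. The algebra $C^*(P)$ contains $\widetilde{\mathcal{K}}(\ell^2(P))$, and in (iii) $\mathbb{C}$ is the subalgebra of scalar multiples of the identity in the quotient. De Polignac's conjecture for an even $n$ is the assertion that there exist infinitely many pairs of primes $p,q$ with $q-p=n$ (the pairs are not required to be consecutive primes). *)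

theory Defs
  imports "HOL-Analysis.Analysis" "HOL-Algebra.QuotRing" "HOL-Computational_Algebra.Primes"
begin

section \<open>The Hilbert space of square-summable families\<close>

typedef 'a ell2 = "{f :: 'a \<Rightarrow> complex. (\<lambda>x. (cmod (f x))\<^sup>2) summable_on UNIV}"
  morphisms ell2_apply Abs_ell2
proof
  show "(\<lambda>_. 0) \<in> {f :: 'a \<Rightarrow> complex. (\<lambda>x. (cmod (f x))\<^sup>2) summable_on UNIV}"
    by simp
qed

setup_lifting type_definition_ell2

lemma ell2_summable: "(\<lambda>x. (cmod (ell2_apply f x))\<^sup>2) summable_on UNIV"
  using ell2_apply[of f] by simp

lemma square_summable_add:
  fixes f g :: "'a \<Rightarrow> complex"
  assumes "(\<lambda>x. (cmod (f x))\<^sup>2) summable_on A" and "(\<lambda>x. (cmod (g x))\<^sup>2) summable_on A"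
  shows "(\<lambda>x. (cmod (f x + g x))\<^sup>2) summable_on A"
proof (rule summable_on_comparison_test)
  show "(\<lambda>x. 2 * (cmod (f x))\<^sup>2 + 2 * (cmod (g x))\<^sup>2) summable_on A"
    using assms by (intro summable_on_add summable_on_cmult_right)
  fix x
  have "(cmod (f x + g x))\<^sup>2 \<le> (cmod (f x) + cmod (g x))\<^sup>2"
    by (intro power_mono norm_triangle_ineq) auto
  also have "\<dots> \<le> 2 * (cmod (f x))\<^sup>2 + 2 * (cmod (g x))\<^sup>2"
    using zero_le_power2[of "cmod (f x) - cmod (g x)"]
    by (simp add: power2_eq_square algebra_simps)
  finally show "(cmod (f x + g x))\<^sup>2 \<le> 2 * (cmod (f x))\<^sup>2 + 2 * (cmod (g x))\<^sup>2" .
qed auto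

lemma square_summable_cmult:
  fixes f :: "'a \<Rightarrow> complex"
  assumes "(\<lambda>x. (cmod (f x))\<^sup>2) summable_on A"
  shows "(\<lambda>x. (cmod (c * f x))\<^sup>2) summable_on A"
  using summable_on_cmult_right[OF assms, of "(cmod c)\<^sup>2"]
  by (simp add: norm_mult power_mult_distrib)

definition cinner :: "'a ell2 \<Rightarrow> 'a ell2 \<Rightarrow> complex"
  where "cinner f g = (\<Sum>\<^sub>\<infinity>x. cnj (ell2_apply f x) * ell2_apply g x)"

lemma cinner_summable: "(\<lambda>x. cnj (ell2_apply f x) * ell2_apply g x) summable_on UNIV"
proof (rule abs_summable_summable, rule summable_on_comparison_test)
  show "(\<lambda>x. (cmod (ell2_apply f x))\<^sup>2 + (cmod (ell2_apply g x))\<^sup>2) summable_on UNIV"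
    by (intro summable_on_add ell2_summable)
  fix x
  show "norm (cnj (ell2_apply f x) * ell2_apply g x)
      \<le> (cmod (ell2_apply f x))\<^sup>2 + (cmod (ell2_apply g x))\<^sup>2"
    using sum_squares_bound[of "cmod (ell2_apply f x)" "cmod (ell2_apply g x)"]
      mult_nonneg_nonneg[OF norm_ge_zero norm_ge_zero, of "ell2_apply f x" "ell2_apply g x"]
    by (simp only: norm_mult complex_mod_cnj)
qed auto

instantiation ell2 :: (type) real_vector
begin

lift_definition zero_ell2 :: "'a ell2" is "\<lambda>_. 0" by simp

lift_definition plus_ell2 :: "'a ell2 \<Rightarrow> 'a ell2 \<Rightarrow> 'a ell2" is "\<lambda>f g x. f x + g x"
  by (rule square_summable_add)

lift_definition uminus_ell2 :: "'a ell2 \<Rightarrow> 'a ell2" is "\<lambda>f x. - f x" by simp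

lift_definition minus_ell2 :: "'a ell2 \<Rightarrow> 'a ell2 \<Rightarrow> 'a ell2" is "\<lambda>f g x. f x - g x"
proof -
  fix f g :: "'a \<Rightarrow> complex"
  assume "(\<lambda>x. (cmod (f x))\<^sup>2) summable_on UNIV" "(\<lambda>x. (cmod (g x))\<^sup>2) summable_on UNIV"
  then show "(\<lambda>x. (cmod (f x - g x))\<^sup>2) summable_on UNIV"
    using square_summable_add[of f UNIV "\<lambda>x. - g x"] by simp
qed

lift_definition scaleR_ell2 :: "real \<Rightarrow> 'a ell2 \<Rightarrow> 'a ell2" is "\<lambda>r f x. complex_of_real r * f x"
  by (rule square_summable_cmult)

instance
  by standard (transfer; simp add: algebra_simps)+

end

lift_definition scaleC :: "complex \<Rightarrow> 'a ell2 \<Rightarrow> 'a ell2" (infixr "*\<^sub>C" 75) is "\<lambda>c f x. c * f x"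
  by (rule square_summable_cmult)

instantiation ell2 :: (type) real_inner
begin

definition inner_ell2 :: "'a ell2 \<Rightarrow> 'a ell2 \<Rightarrow> real"
  where "inner_ell2 f g = Re (cinner f g)"

definition norm_ell2 :: "'a ell2 \<Rightarrow> real"
  where "norm_ell2 f = sqrt (\<Sum>\<^sub>\<infinity>x. (cmod (ell2_apply f x))\<^sup>2)"

definition sgn_ell2 :: "'a ell2 \<Rightarrow> 'a ell2"
  where "sgn_ell2 f = f /\<^sub>R norm f"

definition dist_ell2 :: "'a ell2 \<Rightarrow> 'a ell2 \<Rightarrow> real"
  where "dist_ell2 f g = norm (f - g)"

definition uniformity_ell2 :: "('a ell2 \<times> 'a ell2) filter"
  where "uniformity_ell2 = (INF e\<in>{0<..}. principal {(f, g). dist f g < e})"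

definition open_ell2 :: "'a ell2 set \<Rightarrow> bool"
  where "open_ell2 U \<longleftrightarrow> (\<forall>f\<in>U. eventually (\<lambda>(f', g). f' = f \<longrightarrow> g \<in> U) uniformity)"

instance
proof
  fix f g h :: "'a ell2" and r :: real and U :: "'a ell2 set"
  have self: "inner k k = (\<Sum>\<^sub>\<infinity>x. (cmod (ell2_apply k x))\<^sup>2)" for k :: "'a ell2"
  proof -
    have "cinner k k = (\<Sum>\<^sub>\<infinity>x. complex_of_real ((cmod (ell2_apply k x))\<^sup>2))"
      unfolding cinner_def
      by (intro infsum_cong) (metis complex_norm_square mult.commute)
    then show ?thesis
      unfolding inner_ell2_def
      using infsumI[OF has_sum_of_real[OF has_sum_infsum[OF ell2_summable[of k]]]]
      by (metis Re_complex_of_real)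
  qed
  show "dist f g = norm (f - g)" by (rule dist_ell2_def)
  show "sgn f = f /\<^sub>R norm f" by (rule sgn_ell2_def)
  show "uniformity = (INF e\<in>{0<..}. principal {(f :: 'a ell2, g). dist f g < e})"
    by (rule uniformity_ell2_def)
  show "open U \<longleftrightarrow> (\<forall>f\<in>U. eventually (\<lambda>(f', g). f' = f \<longrightarrow> g \<in> U) uniformity)"
    by (rule open_ell2_def)
  have "cinner g f = cnj (cinner f g)"
    unfolding cinner_def by (simp flip: infsum_cnj add: mult.commute)
  then show "inner f g = inner g f" by (simp add: inner_ell2_def)
  have "cinner (f + g) h = cinner f h + cinner g h"
    unfolding cinner_def
    by (simp add: plus_ell2.rep_eq distrib_right infsum_add cinner_summable)
  then show "inner (f + g) h = inner f h + inner g h" by (simp add: inner_ell2_def)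
  have "cinner (r *\<^sub>R f) g = complex_of_real r * cinner f g"
    unfolding cinner_def
    by (simp add: scaleR_ell2.rep_eq mult.assoc infsum_cmult_right')
  then show "inner (r *\<^sub>R f) g = r * inner f g" by (simp add: inner_ell2_def)
  show "0 \<le> inner f f" unfolding self by (intro infsum_nonneg) simp
  show "inner f f = 0 \<longleftrightarrow> f = 0"
  proof
    assume "inner f f = 0"
    then have "(cmod (ell2_apply f x))\<^sup>2 = 0" for x
      unfolding self
      by (intro nonneg_infsum_le_0D[where A = UNIV]) (auto intro: ell2_summable)
    then show "f = 0" by transfer auto
  next
    assume "f = 0"
    then show "inner f f = 0" unfolding self by (simp add: zero_ell2.rep_eq)
  qed
  show "norm f = sqrt (inner f f)" unfolding self by (rule norm_ell2_def)
qed

end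

lift_definition delta :: "'a \<Rightarrow> 'a ell2" is "\<lambda>x y. if y = x then 1 else 0"
proof -
  fix x :: 'a
  show "(\<lambda>y. (cmod (if y = x then 1 else 0))\<^sup>2) summable_on UNIV"
    by (rule summable_on_cong_neutral[THEN iffD1, of UNIV "{x}"]) auto
qed

section \<open>Operator algebras on the space of square-summable families\<close>

text \<open>
  Isabelle's \<open>blinfun\<close> operators are only real-linear, so the complex-linear ones are
  singled out. On them, the norm and topology of \<open>blinfun\<close> are the operator norm and its topology.
\<close>

definition bounded_ops :: "('a ell2 \<Rightarrow>\<^sub>L 'a ell2) set"
  where "bounded_ops = {T. \<forall>c f. blinfun_apply T (c *\<^sub>C f) = c *\<^sub>C blinfun_apply T f}"

lemma norm_scaleC: "norm (c *\<^sub>C f) = cmod c * norm f"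
  unfolding norm_ell2_def
  by (simp add: scaleC.rep_eq norm_mult power_mult_distrib infsum_cmult_right' real_sqrt_mult)

lift_definition scalar_op :: "complex \<Rightarrow> 'a ell2 \<Rightarrow>\<^sub>L 'a ell2" is scaleC
proof -
  fix c :: complex
  show "bounded_linear ((*\<^sub>C) c :: 'a ell2 \<Rightarrow> 'a ell2)"
  proof (rule bounded_linear_intro)
    show "c *\<^sub>C (f + g) = c *\<^sub>C f + c *\<^sub>C g" for f g :: "'a ell2"
      by transfer (simp add: distrib_left)
    show "c *\<^sub>C (r *\<^sub>R f) = r *\<^sub>R (c *\<^sub>C f)" for r and f :: "'a ell2"
      by transfer (simp add: mult.left_commute)
    show "norm (c *\<^sub>C f) \<le> norm f * cmod c" for f :: "'a ell2"
      by (simp add: norm_scaleC mult.commute)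
  qed
qed

definition adj :: "('a ell2 \<Rightarrow>\<^sub>L 'a ell2) \<Rightarrow> ('a ell2 \<Rightarrow>\<^sub>L 'a ell2)"
  where "adj T = (THE S. \<forall>f g. cinner (blinfun_apply T f) g = cinner f (blinfun_apply S g))"

definition cstar_subalgebra :: "('a ell2 \<Rightarrow>\<^sub>L 'a ell2) set \<Rightarrow> bool"
  where "cstar_subalgebra A \<longleftrightarrow>
    A \<subseteq> bounded_ops \<and> 0 \<in> A \<and>
    (\<forall>S\<in>A. \<forall>T\<in>A. S + T \<in> A) \<and>
    (\<forall>c. \<forall>T\<in>A. scalar_op c o\<^sub>L T \<in> A) \<and>
    (\<forall>S\<in>A. \<forall>T\<in>A. S o\<^sub>L T \<in> A) \<and>
    (\<forall>T\<in>A. adj T \<in> A) \<and>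
    closed A"

definition cstar_generated :: "('a ell2 \<Rightarrow>\<^sub>L 'a ell2) set \<Rightarrow> ('a ell2 \<Rightarrow>\<^sub>L 'a ell2) set"
  where "cstar_generated G = cstar_subalgebra hull G"

definition star_isomorphic :: "('a ell2 \<Rightarrow>\<^sub>L 'a ell2) set \<Rightarrow> ('b ell2 \<Rightarrow>\<^sub>L 'b ell2) set \<Rightarrow> bool"
  where "star_isomorphic A B \<longleftrightarrow> (\<exists>\<phi>. bij_betw \<phi> A B \<and>
    (\<forall>S\<in>A. \<forall>T\<in>A. \<phi> (S + T) = \<phi> S + \<phi> T) \<and>
    (\<forall>c. \<forall>T\<in>A. \<phi> (scalar_op c o\<^sub>L T) = scalar_op c o\<^sub>L \<phi> T) \<and>
    (\<forall>S\<in>A. \<forall>T\<in>A. \<phi> (S o\<^sub>L T) = \<phi> S o\<^sub>L \<phi> T) \<and>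
    (\<forall>T\<in>A. \<phi> (adj T) = adj (\<phi> T)))"

definition compact_ops :: "('a ell2 \<Rightarrow>\<^sub>L 'a ell2) set"
  where "compact_ops = {T \<in> bounded_ops. compact (closure (blinfun_apply T ` cball 0 1))}"

definition unitised_compacts :: "('a ell2 \<Rightarrow>\<^sub>L 'a ell2) set"
  where "unitised_compacts = {K + scalar_op c | K c. K \<in> compact_ops}"

definition op_ring :: "('a ell2 \<Rightarrow>\<^sub>L 'a ell2) set \<Rightarrow> ('a ell2 \<Rightarrow>\<^sub>L 'a ell2) ring"
  where "op_ring A = \<lparr>carrier = A, monoid.mult = (o\<^sub>L), one = id_blinfun, zero = 0, add = (+)\<rparr>"

text \<open>\<open>quotient_scalars A\<close> is the copy of \<open>\<complex>\<close> in the quotient of \<open>A\<close> by the compact operators.\<close>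

definition quotient_scalars :: "('a ell2 \<Rightarrow>\<^sub>L 'a ell2) set \<Rightarrow> ('a ell2 \<Rightarrow>\<^sub>L 'a ell2) set set"
  where "quotient_scalars A = {compact_ops +>\<^bsub>op_ring A\<^esub> scalar_op c | c. True}"

section \<open>Partial translation algebras\<close>

text \<open>
  A subset \<open>X\<close> of the integers is modelled as a type together with its inclusion \<open>incl\<close>,
  so that the square-summable families on \<open>X\<close> form the type \<open>'a ell2\<close>.
\<close>

class int_subset =
  fixes incl :: "'a \<Rightarrow> int"
  assumes inj_incl: "inj incl"

lemma ptrans_reindex:
  fixes f :: "'a::int_subset \<Rightarrow> complex" and n :: int
  defines "D \<equiv> {y :: 'a. incl y - n \<in> range (incl :: 'a \<Rightarrow> int)}"
  defines "g \<equiv> \<lambda>y :: 'a. inv_into UNIV incl (incl y - n) :: 'a"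
  assumes f: "(\<lambda>x. (cmod (f x))\<^sup>2) summable_on UNIV"
  shows "(\<lambda>y. (cmod (if incl y - n \<in> range (incl :: 'a \<Rightarrow> int) then f (g y) else 0))\<^sup>2) summable_on UNIV"
    and "(\<Sum>\<^sub>\<infinity>y. (cmod (if incl y - n \<in> range (incl :: 'a \<Rightarrow> int) then f (g y) else 0))\<^sup>2)
      \<le> (\<Sum>\<^sub>\<infinity>x. (cmod (f x))\<^sup>2)"
proof -
  let ?h = "\<lambda>y. (cmod (if incl y - n \<in> range (incl :: 'a \<Rightarrow> int) then f (g y) else 0))\<^sup>2"
  let ?q = "\<lambda>x. (cmod (f x))\<^sup>2"
  have inj: "inj_on g D"
  proof (rule inj_onI)
    fix y z assume "y \<in> D" "z \<in> D" "g y = g z"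
    then have "incl y - n = incl z - n"
      unfolding D_def g_def by (metis mem_Collect_eq f_inv_into_f)
    then have "incl y = incl z" by simp
    then show "y = z" by (rule injD[OF inj_incl])
  qed
  have q: "?q summable_on g ` D"
    using f by (rule summable_on_subset_banach) simp
  then have "(?q \<circ> g) summable_on D"
    using summable_on_reindex[OF inj] by blast
  moreover have cong: "?h summable_on UNIV \<longleftrightarrow> (?q \<circ> g) summable_on D"
    by (rule summable_on_cong_neutral) (auto simp: D_def)
  ultimately show "?h summable_on UNIV" by blast
  have "infsum ?h UNIV = infsum (?q \<circ> g) D"
    by (rule infsum_cong_neutral) (auto simp: D_def)
  also have "\<dots> = infsum ?q (g ` D)"
    by (rule infsum_reindex[OF inj, symmetric])
  also have "\<dots> \<le> infsum ?q UNIV"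
    by (rule infsum_mono_neutral[OF q f]) auto
  finally show "infsum ?h UNIV \<le> infsum ?q UNIV" .
qed

text \<open>
  The value of \<open>t\<^sub>n f\<close> at \<open>y\<close> is \<open>f (y - n)\<close> if \<open>y - n\<close> lies in the subset, and \<open>0\<close> otherwise;
  on the basis vectors this is the usual description, see \<open>partial_translation_delta\<close> below.
\<close>

lift_definition ptrans_fun :: "int \<Rightarrow> 'a::int_subset ell2 \<Rightarrow> 'a ell2"
  is "\<lambda>n f y. if incl y - n \<in> range (incl :: 'a \<Rightarrow> int) then f (inv_into UNIV incl (incl y - n)) else 0"
  by (rule ptrans_reindex(1))

lift_definition partial_translation :: "int \<Rightarrow> 'a::int_subset ell2 \<Rightarrow>\<^sub>L 'a ell2" is ptrans_fun
proof -
  fix n :: int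
  show "bounded_linear (ptrans_fun n :: 'a ell2 \<Rightarrow> 'a ell2)"
  proof (rule bounded_linear_intro)
    show "ptrans_fun n (f + g) = ptrans_fun n f + ptrans_fun n g" for f g :: "'a ell2"
      by transfer auto
    show "ptrans_fun n (r *\<^sub>R f) = r *\<^sub>R ptrans_fun n f" for r and f :: "'a ell2"
      by transfer auto
    show "norm (ptrans_fun n f) \<le> norm f * 1" for f :: "'a ell2"
      unfolding norm_ell2_def ptrans_fun.rep_eq
      by (simp only: mult_1_right real_sqrt_le_iff) (rule ptrans_reindex(2)[OF ell2_summable])
  qed
qed

lemma partial_translation_delta:
  "blinfun_apply (partial_translation n) (delta (x :: 'a::int_subset)) =
    (if incl x + n \<in> range (incl :: 'a \<Rightarrow> int) then delta (inv_into UNIV incl (incl x + n)) else 0)"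
proof -
  have "ell2_apply (blinfun_apply (partial_translation n) (delta x)) y =
      ell2_apply (if incl x + n \<in> range (incl :: 'a \<Rightarrow> int) then delta (inv_into UNIV incl (incl x + n)) else 0) y" for y
  proof -
    have 1: "incl y - n \<in> range (incl :: 'a \<Rightarrow> int) \<and> inv_into UNIV incl (incl y - n) = x \<longleftrightarrow> incl y = incl x + n"
      using inj_incl
      by (metis add.commute diff_add_cancel add_diff_cancel_right' f_inv_into_f inv_f_f rangeI)
    have 2: "incl x + n \<in> range (incl :: 'a \<Rightarrow> int) \<and> y = inv_into UNIV incl (incl x + n) \<longleftrightarrow> incl y = incl x + n"
      using inj_incl by (metis f_inv_into_f inv_f_f rangeI)
    have "ell2_apply (blinfun_apply (partial_translation n) (delta x)) y =
        (if incl y - n \<in> range (incl :: 'a \<Rightarrow> int) \<and> inv_into UNIV incl (incl y - n) = x then 1 else 0)"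
      by (simp add: partial_translation.rep_eq ptrans_fun.rep_eq delta.rep_eq)
    moreover have "ell2_apply (if incl x + n \<in> range (incl :: 'a \<Rightarrow> int)
            then delta (inv_into UNIV incl (incl x + n)) else 0) y =
        (if incl x + n \<in> range (incl :: 'a \<Rightarrow> int) \<and> y = inv_into UNIV incl (incl x + n) then 1 else 0)"
      by (simp add: delta.rep_eq zero_ell2.rep_eq)
    ultimately show ?thesis unfolding 1 2 by simp
  qed
  then show ?thesis by (simp add: ell2_apply_inject[symmetric] fun_eq_iff)
qed

definition partial_translation_algebra :: "('a::int_subset ell2 \<Rightarrow>\<^sub>L 'a ell2) set"
  where "partial_translation_algebra = cstar_generated (range partial_translation)"

section \<open>The primes\<close>

typedef prime_int = "{p :: int. prime p}"
  morphisms int_of_prime Abs_prime_int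
proof
  show "2 \<in> {p :: int. prime p}" by simp
qed

instantiation prime_int :: int_subset
begin

definition incl_prime_int :: "prime_int \<Rightarrow> int"
  where "incl_prime_int = int_of_prime"

instance
  by standard (simp add: incl_prime_int_def inj_def int_of_prime_inject)

end

abbreviation prime_algebra :: "(prime_int ell2 \<Rightarrow>\<^sub>L prime_int ell2) set"
  where "prime_algebra \<equiv> partial_translation_algebra"

definition de_polignac :: "int \<Rightarrow> bool"
  where "de_polignac n \<longleftrightarrow> infinite {(p :: int, q :: int). prime p \<and> prime q \<and> q - p = n}"

end

theory Submission
  imports Defs
begin

text \<open>
  On \<open>\<ell>\<^sup>2\<close> the compact operators are the norm closure of the finite matrices. Since 2 and 3 are
  the only consecutive primes, the translation by 1 isolates the basis vector at 2, and translating
  it produces all matrix units; hence the algebra of the primes contains the unitised compacts.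

  If no even distance occurs infinitely often, each translation by \<open>n \<noteq> 0\<close> is a finite matrix
  (for odd \<open>n\<close> one prime of a pair is 2), so the algebra equals the unitised compacts.

  Otherwise consider the projection \<open>p = t\<^sub>-\<^sub>n t\<^sub>n\<close> onto the primes \<open>x\<close> with \<open>x + n\<close> prime. Both
  these primes and the remaining ones are infinite in number. Under an isomorphism onto the
  unitised compacts, the diagonal matrix units become nonzero orthogonal projections; unit vectors
  in their ranges are an orthonormal family on which the image \<open>K + c\<close> of \<open>p\<close> has both eigenvalues
  1 and 0 infinitely often. Compactness of \<open>K\<close> forces \<open>c = 1\<close> and \<open>c = 0\<close>. Applied to the basis
  vectors, the same argument shows that \<open>p\<close> itself is not scalar modulo the compacts.
\<close>

section \<open>Adjoints and completeness\<close>

lemma ell2_eqI: "(\<And>x. ell2_apply f x = ell2_apply g x) \<Longrightarrow> f = g"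
  by (simp add: ell2_apply_inject[symmetric] fun_eq_iff)

lemma ell2_apply_sum: "ell2_apply (\<Sum>i\<in>I. f i) x = (\<Sum>i\<in>I. ell2_apply (f i) x)"
  by (induction I rule: infinite_finite_induct) (simp_all add: zero_ell2.rep_eq plus_ell2.rep_eq)

lemma cinner_commute: "cinner g f = cnj (cinner f g)"
  unfolding cinner_def by (simp flip: infsum_cnj add: mult.commute)

lemma cinner_add_right: "cinner f (g + h) = cinner f g + cinner f h"
  unfolding cinner_def by (simp add: plus_ell2.rep_eq distrib_left infsum_add cinner_summable)

lemma cinner_add_left: "cinner (f + g) h = cinner f h + cinner g h"
  by (subst (1 2 3) cinner_commute) (simp add: cinner_add_right)

lemma cinner_scaleC_right: "cinner f (c *\<^sub>C g) = c * cinner f g"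
  unfolding cinner_def by (simp add: scaleC.rep_eq mult.left_commute infsum_cmult_right')

lemma cinner_scaleC_left: "cinner (c *\<^sub>C f) g = cnj c * cinner f g"
  by (subst (1 2) cinner_commute) (simp add: cinner_scaleC_right)

lemma scaleR_eq_scaleC: "r *\<^sub>R f = complex_of_real r *\<^sub>C (f :: 'a ell2)"
  by transfer simp

lemma scaleC_minus_one: "(- 1) *\<^sub>C f = - (f :: 'a ell2)"
  by transfer simp

lemma scaleC_scaleC: "a *\<^sub>C b *\<^sub>C f = (a * b) *\<^sub>C (f :: 'a ell2)"
  by transfer (simp add: mult.assoc)

lemma cinner_diff_right: "cinner f (g - h) = cinner f g - cinner f h"
  using cinner_add_right[of f "g - h" h] by simp

lemma cinner_diff_left: "cinner (f - g) h = cinner f h - cinner g h"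
  using cinner_add_left[of "f - g" g h] by simp

lemma cinner_zero [simp]: "cinner 0 f = 0" "cinner f 0 = 0"
  using cinner_diff_left[of f f f] cinner_diff_right[of f f f] by simp_all

lemma cinner_sum_left: "cinner (\<Sum>i\<in>I. f i) g = (\<Sum>i\<in>I. cinner (f i) g)"
  by (induction I rule: infinite_finite_induct) (simp_all add: cinner_add_left)

lemma cinner_sum_right: "cinner g (\<Sum>i\<in>I. f i) = (\<Sum>i\<in>I. cinner g (f i))"
  by (induction I rule: infinite_finite_induct) (simp_all add: cinner_add_right)

lemma cinner_self: "cinner f f = complex_of_real ((norm f)\<^sup>2)"
proof -
  have "cinner f f = cnj (cinner f f)"
    by (rule cinner_commute)
  then have "Im (cinner f f) = 0"
    by (metis complex_cnj complex.sel(2) complex_surj neg_equal_zero)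
  then show ?thesis
    by (simp add: complex_eq_iff power2_norm_eq_inner inner_ell2_def)
qed

text \<open>The real Cauchy-Schwarz inequality only sees the real part of \<open>cinner\<close>.
  Rotating \<open>g\<close> by a unimodular factor \<open>c\<close> makes the inner product with
  \<open>f\<close> real and nonnegative without changing norms.\<close>

lemma norm_cinner_le: "cmod (cinner f g) \<le> norm f * norm g"
proof (cases "cinner f g = 0")
  case False
  define c where "c = cnj (cinner f g) / cmod (cinner f g)"
  have "cmod c = 1"
    using False by (simp add: c_def norm_divide)
  have "cinner f (c *\<^sub>C g) = complex_of_real (cmod (cinner f g))"
    using False complex_norm_square[of "cinner f g"]
    by (simp add: cinner_scaleC_right c_def field_simps power2_eq_square)
  then have "cmod (cinner f g) = inner f (c *\<^sub>C g)"
    by (simp add: inner_ell2_def)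
  also have "\<dots> \<le> norm f * norm (c *\<^sub>C g)"
    by (rule norm_cauchy_schwarz)
  finally show ?thesis
    by (simp add: norm_scaleC \<open>cmod c = 1\<close>)
qed simp

lemma cinner_delta_left: "cinner (delta x) f = ell2_apply f x"
proof -
  have "cinner (delta x) f = (\<Sum>\<^sub>\<infinity>y\<in>{x}. ell2_apply f y)"
    unfolding cinner_def by (rule infsum_cong_neutral) (auto simp: delta.rep_eq)
  then show ?thesis
    by simp
qed

lemma cinner_delta_right: "cinner f (delta x) = cnj (ell2_apply f x)"
  by (subst cinner_commute) (simp add: cinner_delta_left)

lemma norm_delta [simp]: "norm (delta x) = 1"
proof -
  have "complex_of_real ((norm (delta x))\<^sup>2) = 1"
    unfolding cinner_self[symmetric] by (simp add: cinner_delta_left delta.rep_eq)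
  then have "(norm (delta x))\<^sup>2 = 1"
    by (metis of_real_eq_1_iff)
  then show ?thesis
    using norm_ge_zero[of "delta x"] by (simp add: power2_eq_1_iff)
qed

lemma cmod_ell2_apply_le: "cmod (ell2_apply f x) \<le> norm f"
  using norm_cinner_le[of "delta x" f] by (simp add: cinner_delta_left)

lemma cinner_eqI: "(\<And>f. cinner f g = cinner f h) \<Longrightarrow> g = h"
  by (rule ell2_eqI) (metis cinner_delta_left)

section \<open>Truncation to finitely many coordinates\<close>

lemma norm_ell2_power2: "(norm f)\<^sup>2 = (\<Sum>\<^sub>\<infinity>x. (cmod (ell2_apply f x))\<^sup>2)"
  unfolding norm_ell2_def by (intro real_sqrt_pow2 infsum_nonneg) simp

text \<open>Orthogonal projection onto the coordinates in \<open>F\<close>, meant for finite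
  \<open>F\<close>: over an infinite set the sum is 0 by convention.\<close>

definition coord_trunc :: "'a set \<Rightarrow> 'a ell2 \<Rightarrow> 'a ell2"
  where "coord_trunc F f = (\<Sum>x\<in>F. ell2_apply f x *\<^sub>C delta x)"

lemma ell2_apply_coord_trunc:
  "finite F \<Longrightarrow> ell2_apply (coord_trunc F f) x = (if x \<in> F then ell2_apply f x else 0)"
  by (simp add: coord_trunc_def ell2_apply_sum scaleC.rep_eq delta.rep_eq if_distrib[of "\<lambda>z. _ * z"] cong: if_cong)

text \<open>Pythagoras: the difference is supported off \<open>F\<close>, and the square sum splits
  over \<open>F\<close> and its complement.\<close>

lemma norm_diff_coord_trunc:
  assumes "finite F"
  shows "(norm (f - coord_trunc F f))\<^sup>2 = (norm f)\<^sup>2 - (\<Sum>x\<in>F. (cmod (ell2_apply f x))\<^sup>2)"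
proof -
  let ?q = "\<lambda>x. (cmod (ell2_apply f x))\<^sup>2"
  have sub: "?q summable_on (- F)"
    by (rule summable_on_subset_banach[OF ell2_summable]) simp
  have "(norm (f - coord_trunc F f))\<^sup>2 = infsum ?q (- F)"
    unfolding norm_ell2_power2
    by (rule infsum_cong_neutral) (auto simp: minus_ell2.rep_eq ell2_apply_coord_trunc assms)
  moreover have "infsum ?q (F \<union> - F) = infsum ?q F + infsum ?q (- F)"
    by (rule infsum_Un_disjoint) (use assms sub in auto)
  ultimately show ?thesis
    using assms by (simp add: norm_ell2_power2)
qed

text \<open>Stated along the filter of finite sets so that one \<open>F\<close> can serve finitely
  many vectors at once.\<close>

lemma eventually_norm_diff_coord_trunc:
  assumes "0 < e"
  shows "eventually (\<lambda>F. norm (f - coord_trunc F f) < e) (finite_subsets_at_top UNIV)"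
proof -
  let ?q = "\<lambda>x. (cmod (ell2_apply f x))\<^sup>2"
  have "(sum ?q \<longlongrightarrow> (norm f)\<^sup>2) (finite_subsets_at_top UNIV)"
    unfolding norm_ell2_power2 using ell2_summable by (rule infsum_tendsto)
  then have "eventually (\<lambda>F. (norm f)\<^sup>2 - e\<^sup>2 < sum ?q F) (finite_subsets_at_top UNIV)"
    by (rule order_tendstoD) (use assms in simp)
  moreover have "eventually (\<lambda>F. finite F) (finite_subsets_at_top (UNIV :: 'a set))"
    by (simp add: eventually_finite_subsets_at_top_weakI)
  ultimately show ?thesis
  proof eventually_elim
    case (elim F)
    then have "(norm (f - coord_trunc F f))\<^sup>2 < e\<^sup>2"
      by (simp add: norm_diff_coord_trunc)
    then show ?case
      using assms by (simp add: power2_less_imp_less)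
  qed
qed

lemma coord_trunc_approx:
  assumes "0 < e"
  obtains F where "finite F" "norm (f - coord_trunc F f) < e"
proof -
  have "eventually (\<lambda>F. finite F \<and> norm (f - coord_trunc F f) < e) (finite_subsets_at_top UNIV)"
    using eventually_norm_diff_coord_trunc[OF assms]
    by (intro eventually_conj) (simp_all add: eventually_finite_subsets_at_top_weakI)
  from eventually_happens[OF this] show ?thesis
    using that by auto
qed

section \<open>Riesz representation and existence of adjoints\<close>

lemma riesz_representation:
  fixes l :: "'a ell2 \<Rightarrow> complex"
  assumes add: "\<And>f g. l (f + g) = l f + l g"
    and scale: "\<And>c f. l (c *\<^sub>C f) = c * l f"
    and bound: "\<And>f. cmod (l f) \<le> M * norm f"
  obtains h where "\<And>f. l f = cinner h f"
proof -
  have l0: "l 0 = 0"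
    using add[of 0 0] by simp
  have lsum: "l (\<Sum>i\<in>I. g i) = (\<Sum>i\<in>I. l (g i))" for g :: "'a \<Rightarrow> 'a ell2" and I
    by (induction I rule: infinite_finite_induct) (simp_all add: l0 add)
  \<comment> \<open>The coordinates that a representing vector must have, since
    \<open>l (delta x)\<close> has to be \<open>cinner h (delta x)\<close>.\<close>
  define a where "a x = cnj (l (delta x))" for x
  \<comment> \<open>Evaluating \<open>l\<close> at the vector with coordinates \<open>a\<close> on
    \<open>F\<close> gives the partial sum \<open>?S\<close>, while the bound on \<open>l\<close>
    gives \<open>?S \<le> M * sqrt ?S\<close>; hence \<open>sqrt ?S\<close> is zero or at most
    \<open>M\<close>.\<close>
  have fin_bound: "(\<Sum>x\<in>F. (cmod (a x))\<^sup>2) \<le> M\<^sup>2" if F: "finite F" for F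
  proof -
    define g where "g = (\<Sum>x\<in>F. a x *\<^sub>C delta x)"
    let ?S = "\<Sum>x\<in>F. (cmod (a x))\<^sup>2"
    have gx: "ell2_apply g x = (if x \<in> F then a x else 0)" for x
      using F by (simp add: g_def ell2_apply_sum scaleC.rep_eq delta.rep_eq
          if_distrib[of "\<lambda>z. _ * z"] cong: if_cong)
    have "l g = (\<Sum>x\<in>F. a x * cnj (a x))"
      by (simp add: g_def lsum scale) (simp add: a_def)
    then have lg: "l g = complex_of_real ?S"
      by (simp flip: complex_norm_square)
    have "(norm g)\<^sup>2 = (\<Sum>\<^sub>\<infinity>x\<in>F. (cmod (a x))\<^sup>2)"
      unfolding norm_ell2_power2 by (rule infsum_cong_neutral) (auto simp: gx)
    then have ng: "(norm g)\<^sup>2 = ?S"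
      using F by simp
    have "?S = cmod (l g)"
      unfolding lg norm_of_real by (simp add: sum_nonneg)
    also have "\<dots> \<le> M * norm g"
      by (rule bound)
    finally have "norm g * norm g \<le> M * norm g"
      using ng by (simp add: power2_eq_square)
    then have "norm g = 0 \<or> norm g \<le> M"
      using norm_ge_zero[of g] by (metis less_eq_real_def mult_le_cancel_right not_less)
    then show ?thesis
      unfolding ng[symmetric] by (auto intro: power_mono)
  qed
  have summ: "(\<lambda>x. (cmod (a x))\<^sup>2) summable_on UNIV"
    by (rule nonneg_bdd_above_summable_on) (auto intro!: bdd_aboveI fin_bound)
  define h where "h = Abs_ell2 a"
  have hx: "ell2_apply h x = a x" for x
    unfolding h_def using summ by (simp add: Abs_ell2_inverse)
  have "l f = cinner h f" for f
  proof -
    \<comment> \<open>The error functional \<open>d\<close> is bounded and vanishes on truncations,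
      which approximate every vector; so it vanishes everywhere.\<close>
    define d where "d f = l f - cinner h f" for f
    have dsub: "d f = d g + d (f - g)" for f g
      using add[of g "f - g"] cinner_add_right[of h g "f - g"] by (simp add: d_def)
    have dbound: "cmod (d f) \<le> (M + norm h) * norm f" for f
      using norm_triangle_ineq4[of "l f" "cinner h f"] bound[of f] norm_cinner_le[of h f]
      by (simp add: d_def distrib_right)
    have dtr: "d (coord_trunc F f) = 0" for F
      by (simp add: d_def coord_trunc_def lsum cinner_sum_right scale cinner_scaleC_right cinner_delta_right hx a_def)
    have "cmod (d f) \<le> 0 + e" if e: "e > 0" for e :: real
    proof -
      \<comment> \<open>The sign of \<open>M\<close> is not fixed; the absolute value and the added
        1 give a strictly positive bound that can be divided by.\<close>
      let ?C = "\<bar>M\<bar> + norm h + 1"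
      have C: "?C > 0"
        by (simp add: add_nonneg_pos)
      obtain F where "norm (f - coord_trunc F f) < e / ?C"
        using coord_trunc_approx[OF divide_pos_pos[OF e C]] by metis
      then have "?C * norm (f - coord_trunc F f) \<le> e"
        using C by (simp add: field_simps)
      moreover have "(M + norm h) * norm (f - coord_trunc F f) \<le> ?C * norm (f - coord_trunc F f)"
        by (intro mult_right_mono) auto
      ultimately show ?thesis
        using dbound[of "f - coord_trunc F f"] dsub[of f "coord_trunc F f"] dtr[of F] by simp
    qed
    then have "cmod (d f) \<le> 0"
      by (rule field_le_epsilon)
    then show ?thesis
      by (simp add: d_def)
  qed
  then show ?thesis
    by (rule that)
qed

lemma bounded_ops_scaleC: "T \<in> bounded_ops \<Longrightarrow> blinfun_apply T (c *\<^sub>C f) = c *\<^sub>C blinfun_apply T f"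
  by (simp add: bounded_ops_def)

text \<open>\<open>adj\<close> is a definite description; inner products separate vectors, so any
  \<open>S\<close> satisfying the adjoint relation is the described operator.\<close>

lemma adj_eqI:
  assumes "\<And>f g. cinner (blinfun_apply T f) g = cinner f (blinfun_apply S g)"
  shows "adj T = S"
  unfolding adj_def
proof (rule the_equality)
  fix R assume "\<forall>f g. cinner (blinfun_apply T f) g = cinner f (blinfun_apply R g)"
  then show "R = S"
    using assms by (intro blinfun_eqI cinner_eqI) simp
qed (use assms in simp)

text \<open>For each \<open>g\<close>, Riesz represents the functional taking \<open>f\<close> to
  \<open>cinner g (T f)\<close> by a vector \<open>S g\<close>. The norm bound holds because the
  square of \<open>norm (S g)\<close> is \<open>cinner (T (S g)) g\<close>.\<close>

lemma adjoint_exists: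
  fixes T :: "'a ell2 \<Rightarrow>\<^sub>L 'a ell2"
  assumes T: "T \<in> bounded_ops"
  shows "\<exists>S\<in>bounded_ops. norm S \<le> norm T \<and>
    (\<forall>f g. cinner (blinfun_apply T f) g = cinner f (blinfun_apply S g))"
proof -
  have "\<exists>h. \<forall>f. cinner g (blinfun_apply T f) = cinner h f" for g
  proof -
    obtain h where "\<And>f. cinner g (blinfun_apply T f) = cinner h f"
    proof (rule riesz_representation[of "\<lambda>f. cinner g (blinfun_apply T f)" "norm g * norm T"])
      show "cmod (cinner g (blinfun_apply T f)) \<le> norm g * norm T * norm f" for f
        using norm_cinner_le[of g "blinfun_apply T f"]
          mult_left_mono[OF norm_blinfun[of T f] norm_ge_zero[of g]] by (simp add: mult.assoc)
    qed (simp_all add: blinfun.add_right cinner_add_right bounded_ops_scaleC[OF T] cinner_scaleC_right)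
    then show ?thesis
      by auto
  qed
  then obtain S where S: "\<And>f g. cinner g (blinfun_apply T f) = cinner (S g) f"
    by metis
  then have S': "cinner f (S g) = cinner (blinfun_apply T f) g" for f g
    by (metis cinner_commute)
  have bnd: "norm (S g) \<le> norm g * norm T" for g
  proof -
    have "norm (S g) * norm (S g) = cmod (cinner (blinfun_apply T (S g)) g)"
      unfolding S'[symmetric] cinner_self by (simp add: power2_eq_square norm_mult)
    also have "\<dots> \<le> norm (blinfun_apply T (S g)) * norm g"
      by (rule norm_cinner_le)
    also have "\<dots> \<le> norm T * norm (S g) * norm g"
      by (intro mult_right_mono norm_blinfun) simp
    finally have "norm (S g) * norm (S g) \<le> (norm g * norm T) * norm (S g)"
      by (simp add: mult_ac)
    then show ?thesis
      by (metis norm_ge_zero mult_nonneg_nonneg less_eq_real_def mult_le_cancel_right not_less)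
  qed
  have bl: "bounded_linear S"
  proof (rule bounded_linear_intro)
    show "S (f + g) = S f + S g" for f g
      by (rule cinner_eqI) (simp add: S' cinner_add_right)
    show "S (r *\<^sub>R f) = r *\<^sub>R S f" for r f
      by (rule cinner_eqI) (simp add: S' scaleR_eq_scaleC cinner_scaleC_right)
  qed (rule bnd)
  note app = bounded_linear_Blinfun_apply[OF bl]
  have "Blinfun S \<in> bounded_ops"
    unfolding bounded_ops_def
    by (auto simp: app intro!: cinner_eqI) (simp add: S' cinner_scaleC_right)
  moreover have "norm (Blinfun S) \<le> norm T"
    by (rule norm_blinfun_bound) (use bnd in \<open>simp_all add: app mult.commute\<close>)
  ultimately show ?thesis
    using app S' by auto
qed

lemma
  assumes "T \<in> bounded_ops"
  shows adj_bounded_ops: "adj T \<in> bounded_ops"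
    and norm_adj_le: "norm (adj T) \<le> norm T"
    and cinner_adj: "cinner (blinfun_apply T f) g = cinner f (blinfun_apply (adj T) g)"
proof -
  obtain S where "S \<in> bounded_ops" "norm S \<le> norm T"
    "\<And>f g. cinner (blinfun_apply T f) g = cinner f (blinfun_apply S g)"
    using adjoint_exists[OF assms] by auto
  moreover from this(3) have "adj T = S"
    by (rule adj_eqI)
  ultimately show "adj T \<in> bounded_ops" "norm (adj T) \<le> norm T"
    "cinner (blinfun_apply T f) g = cinner f (blinfun_apply (adj T) g)"
    by auto
qed

text \<open>Coordinatewise limits exist because coordinates are 1-Lipschitz; uniform bounds on
  finite partial sums show that the limit is square-summable and a limit in norm. Completeness later
  lets compactness be checked by total boundedness.\<close>

instance ell2 :: (type) complete_space
proof
  fix X :: "nat \<Rightarrow> 'a ell2"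
  assume X: "Cauchy X"
  have "Cauchy (\<lambda>n. ell2_apply (X n) x)" for x
  proof (rule metric_CauchyI)
    fix e :: real assume "e > 0"
    then obtain N where N: "\<And>m n. m \<ge> N \<Longrightarrow> n \<ge> N \<Longrightarrow> dist (X m) (X n) < e"
      using metric_CauchyD[OF X] by metis
    have "dist (ell2_apply (X m) x) (ell2_apply (X n) x) \<le> dist (X m) (X n)" for m n
      using cmod_ell2_apply_le[of "X m - X n" x] by (simp add: dist_norm minus_ell2.rep_eq)
    then show "\<exists>M. \<forall>m\<ge>M. \<forall>n\<ge>M. dist (ell2_apply (X m) x) (ell2_apply (X n) x) < e"
      using N by (meson le_less_trans)
  qed
  then have "\<exists>l. (\<lambda>n. ell2_apply (X n) x) \<longlonglongrightarrow> l" for x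
    by (simp add: Cauchy_convergent_iff convergent_def)
  then obtain f where f: "\<And>x. (\<lambda>n. ell2_apply (X n) x) \<longlonglongrightarrow> f x"
    by metis
  \<comment> \<open>The bound holds with \<open>X m\<close> in place of the limit for all large
    \<open>m\<close>. Each partial sum is finite, so \<open>m\<close> can go to infinity, and
    \<open>N\<close> does not depend on \<open>F\<close>.\<close>
  have fin: "\<exists>N. \<forall>n\<ge>N. \<forall>F. finite F \<longrightarrow> (\<Sum>x\<in>F. (cmod (ell2_apply (X n) x - f x))\<^sup>2) \<le> e\<^sup>2"
    if e: "e > 0" for e :: real
  proof -
    obtain N where N: "\<And>m n. m \<ge> N \<Longrightarrow> n \<ge> N \<Longrightarrow> dist (X m) (X n) < e"
      using metric_CauchyD[OF X e] by metis
    show ?thesis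
    proof (intro exI[of _ N] allI impI)
      fix n F assume n: "n \<ge> N" and F: "finite (F :: 'a set)"
      have "(\<lambda>m. \<Sum>x\<in>F. (cmod (ell2_apply (X n) x - ell2_apply (X m) x))\<^sup>2)
          \<longlonglongrightarrow> (\<Sum>x\<in>F. (cmod (ell2_apply (X n) x - f x))\<^sup>2)"
        by (intro tendsto_intros f)
      moreover have "(\<Sum>x\<in>F. (cmod (ell2_apply (X n) x - ell2_apply (X m) x))\<^sup>2) \<le> e\<^sup>2" if "m \<ge> N" for m
      proof -
        have "(\<Sum>x\<in>F. (cmod (ell2_apply (X n - X m) x))\<^sup>2) \<le> (norm (X n - X m))\<^sup>2"
          unfolding norm_ell2_power2 using F ell2_summable by (intro finite_sum_le_infsum) auto
        also have "\<dots> \<le> e\<^sup>2"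
          using N[OF n that] by (intro power_mono) (simp_all add: dist_norm)
        finally show ?thesis
          by (simp add: minus_ell2.rep_eq)
      qed
      ultimately show "(\<Sum>x\<in>F. (cmod (ell2_apply (X n) x - f x))\<^sup>2) \<le> e\<^sup>2"
        by (intro LIMSEQ_le_const2) auto
    qed
  qed
  have summ: "\<exists>N. \<forall>n\<ge>N. (\<lambda>x. (cmod (ell2_apply (X n) x - f x))\<^sup>2) summable_on UNIV \<and>
      (\<Sum>\<^sub>\<infinity>x. (cmod (ell2_apply (X n) x - f x))\<^sup>2) \<le> e\<^sup>2" if e: "e > 0" for e :: real
  proof -
    obtain N where N: "\<And>n F. n \<ge> N \<Longrightarrow> finite F \<Longrightarrow> (\<Sum>x\<in>F. (cmod (ell2_apply (X n) x - f x))\<^sup>2) \<le> e\<^sup>2"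
      using fin[OF e] by metis
    have s: "(\<lambda>x. (cmod (ell2_apply (X n) x - f x))\<^sup>2) summable_on UNIV" if "n \<ge> N" for n
      by (rule nonneg_bdd_above_summable_on) (auto intro!: bdd_aboveI N that)
    then show ?thesis
      using N by (auto intro!: exI[of _ N] infsum_le_finite_sums)
  qed
  obtain N where "(\<lambda>x. (cmod (ell2_apply (X N) x - f x))\<^sup>2) summable_on UNIV"
    using summ[of 1] by auto
  then have "(\<lambda>x. (cmod (f x - ell2_apply (X N) x))\<^sup>2) summable_on UNIV"
    by (simp add: norm_minus_commute)
  from square_summable_add[OF this ell2_summable[of "X N"]]
  have fs: "(\<lambda>x. (cmod (f x))\<^sup>2) summable_on UNIV"
    by simp
  define L where "L = Abs_ell2 f"
  have Lx: "ell2_apply L x = f x" for x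
    unfolding L_def using fs by (simp add: Abs_ell2_inverse)
  have "X \<longlonglongrightarrow> L"
  proof (rule metric_LIMSEQ_I)
    fix e :: real assume e: "e > 0"
    then obtain N where N: "\<And>n. n \<ge> N \<Longrightarrow> (\<Sum>\<^sub>\<infinity>x. (cmod (ell2_apply (X n) x - f x))\<^sup>2) \<le> (e/2)\<^sup>2"
      using summ[of "e/2"] by auto
    have "(norm (X n - L))\<^sup>2 \<le> (e/2)\<^sup>2" if "n \<ge> N" for n
      using N[OF that] by (simp add: norm_ell2_power2 minus_ell2.rep_eq Lx)
    then have "norm (X n - L) \<le> e/2" if "n \<ge> N" for n
      using that e by (meson power2_le_imp_le half_gt_zero less_imp_le)
    then show "\<exists>N. \<forall>n\<ge>N. dist (X n) L < e"
      using e by (intro exI[of _ N] allI impI) (fastforce simp: dist_norm)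
  qed
  then show "convergent X"
    by (auto simp: convergent_def)
qed

section \<open>Complex scalars and the complex-linear operators\<close>

lemma scaleC_zero [simp]: "c *\<^sub>C (0 :: 'a ell2) = 0" "0 *\<^sub>C f = (0 :: 'a ell2)"
  by (transfer, simp)+

lemma scaleC_one [simp]: "1 *\<^sub>C f = (f :: 'a ell2)"
  by transfer simp

lemma scaleC_add_right: "c *\<^sub>C (f + g) = c *\<^sub>C f + c *\<^sub>C (g :: 'a ell2)"
  by transfer (simp add: distrib_left)

lemma scaleC_add_left: "(a + b) *\<^sub>C f = a *\<^sub>C f + b *\<^sub>C (f :: 'a ell2)"
  by transfer (simp add: distrib_right)

lemma scaleC_sum_right: "c *\<^sub>C (\<Sum>i\<in>I. f i) = (\<Sum>i\<in>I. c *\<^sub>C (f i :: 'a ell2))"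
  by (induction I rule: infinite_finite_induct) (simp_all add: scaleC_add_right)

lemma scaleC_diff_right: "c *\<^sub>C (f - g) = c *\<^sub>C f - c *\<^sub>C (g :: 'a ell2)"
  by transfer (simp add: right_diff_distrib)

lemma scaleC_diff_left: "(a - b) *\<^sub>C f = a *\<^sub>C f - b *\<^sub>C (f :: 'a ell2)"
  by transfer (simp add: left_diff_distrib)

lemma scaleC_minus_left: "(- a) *\<^sub>C f = - (a *\<^sub>C f :: 'a ell2)"
  by transfer simp

lemma bounded_linear_scaleC_left: "bounded_linear (\<lambda>c. c *\<^sub>C (f :: 'a ell2))"
proof (rule bounded_linear_intro[where K = "norm f"])
  show "(r *\<^sub>R c) *\<^sub>C f = r *\<^sub>R c *\<^sub>C f" for r c
    by (simp add: scaleR_eq_scaleC scaleC_scaleC scaleR_conv_of_real)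
qed (simp_all add: scaleC_add_left norm_scaleC)

lemma scalar_op_apply [simp]: "blinfun_apply (scalar_op c) f = c *\<^sub>C f"
  by (simp add: scalar_op.rep_eq)

lemma blinfun_compose_assoc: "(A o\<^sub>L B) o\<^sub>L C = A o\<^sub>L (B o\<^sub>L C)"
  by (rule blinfun_eqI) simp

lemmas blinfun_compose_add_left = bounded_bilinear.add_left[OF bounded_bilinear_blinfun_compose]
lemmas blinfun_compose_add_right = bounded_bilinear.add_right[OF bounded_bilinear_blinfun_compose]
lemmas blinfun_compose_sum_left = bounded_bilinear.sum_left[OF bounded_bilinear_blinfun_compose]
lemmas blinfun_compose_sum_right = bounded_bilinear.sum_right[OF bounded_bilinear_blinfun_compose]

lemma bounded_opsI: "(\<And>c f. blinfun_apply T (c *\<^sub>C f) = c *\<^sub>C blinfun_apply T f) \<Longrightarrow> T \<in> bounded_ops"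
  by (simp add: bounded_ops_def)

lemma scalar_op_bounded_ops: "scalar_op c \<in> bounded_ops"
  by (rule bounded_opsI) (simp add: scaleC_scaleC mult.commute)

lemma zero_bounded_ops: "0 \<in> bounded_ops"
  by (rule bounded_opsI) simp

lemma add_bounded_ops: "S \<in> bounded_ops \<Longrightarrow> T \<in> bounded_ops \<Longrightarrow> S + T \<in> bounded_ops"
  by (auto intro!: bounded_opsI simp: blinfun.add_left bounded_ops_scaleC scaleC_add_right)

lemma diff_bounded_ops: "S \<in> bounded_ops \<Longrightarrow> T \<in> bounded_ops \<Longrightarrow> S - T \<in> bounded_ops"
  by (auto intro!: bounded_opsI simp: blinfun.diff_left bounded_ops_scaleC scaleC_diff_right)

lemma compose_bounded_ops: "S \<in> bounded_ops \<Longrightarrow> T \<in> bounded_ops \<Longrightarrow> S o\<^sub>L T \<in> bounded_ops"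
  by (auto intro!: bounded_opsI simp: bounded_ops_scaleC)

text \<open>Evaluation at a vector is continuous in the operator, so each instance of complex
  homogeneity is a closed condition.\<close>

lemma closed_bounded_ops: "closed (bounded_ops :: ('a ell2 \<Rightarrow>\<^sub>L 'a ell2) set)"
proof -
  have "bounded_ops = (\<Inter>c. \<Inter>f :: 'a ell2. {T. blinfun_apply T (c *\<^sub>C f) = blinfun_apply (scalar_op c) (blinfun_apply T f)})"
    by (auto simp: bounded_ops_def)
  moreover have "closed \<dots>"
    by (intro closed_INT ballI closed_Collect_eq continuous_intros)
  ultimately show ?thesis
    by simp
qed

section \<open>Finite matrices and compact operators\<close>

lemma norm_blinfun_le_unit_ball:
  fixes A :: "'a::real_normed_vector \<Rightarrow>\<^sub>L 'b::real_normed_vector"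
  assumes "\<And>f. norm f \<le> 1 \<Longrightarrow> norm (blinfun_apply A f) \<le> b"
  shows "norm A \<le> b"
proof (rule norm_blinfun_bound)
  show "0 \<le> b"
    using assms[of 0] by simp
  show "norm (blinfun_apply A f) \<le> b * norm f" for f
  proof (cases "f = 0")
    case False
    then show ?thesis
      using assms[of "f /\<^sub>R norm f"] by (simp add: blinfun.scaleR_right field_simps)
  qed simp
qed

section \<open>Matrix units and finite matrices\<close>

lift_definition matrix_unit :: "'a \<Rightarrow> 'a \<Rightarrow> 'a ell2 \<Rightarrow>\<^sub>L 'a ell2"
  is "\<lambda>x y f. ell2_apply f y *\<^sub>C delta x"
proof -
  fix x y :: 'a
  show "bounded_linear (\<lambda>f. ell2_apply f y *\<^sub>C delta x)"
    by (rule bounded_linear_intro[where K = 1])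
      (simp_all add: plus_ell2.rep_eq scaleC.rep_eq scaleC_add_left scaleR_eq_scaleC
        scaleC_scaleC norm_scaleC cmod_ell2_apply_le)
qed

lemma matrix_unit_apply [simp]: "blinfun_apply (matrix_unit x y) f = ell2_apply f y *\<^sub>C delta x"
  by (simp add: matrix_unit.rep_eq)

lemma matrix_unit_bounded_ops: "matrix_unit x y \<in> bounded_ops"
  by (rule bounded_opsI) (simp add: scaleC.rep_eq scaleC_scaleC)

lemma adj_matrix_unit: "adj (matrix_unit x y) = matrix_unit y x"
  by (rule adj_eqI)
    (simp add: cinner_scaleC_left cinner_scaleC_right cinner_delta_left cinner_delta_right)

text \<open>The sandwich picks out the entry of \<open>T\<close> in row \<open>x\<close> and column
  \<open>y\<close>. Summed over a finite block, this writes a finite matrix as a linear combination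
  of matrix units.\<close>

lemma matrix_unit_sandwich:
  assumes "T \<in> bounded_ops"
  shows "matrix_unit x x o\<^sub>L T o\<^sub>L matrix_unit y y
    = scalar_op (ell2_apply (blinfun_apply T (delta y)) x) o\<^sub>L matrix_unit x y"
  by (rule blinfun_eqI)
    (simp add: bounded_ops_scaleC[OF assms] scaleC.rep_eq scaleC_scaleC mult.commute)

definition coord_proj :: "'a set \<Rightarrow> 'a ell2 \<Rightarrow>\<^sub>L 'a ell2"
  where "coord_proj F = (\<Sum>x\<in>F. matrix_unit x x)"

lemma coord_proj_apply [simp]: "blinfun_apply (coord_proj F) f = coord_trunc F f"
  by (simp add: coord_proj_def coord_trunc_def blinfun.sum_left)

lemma coord_trunc_scaleC: "coord_trunc F (c *\<^sub>C f) = c *\<^sub>C coord_trunc F f"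
  by (simp add: coord_trunc_def scaleC_sum_right scaleC.rep_eq scaleC_scaleC)

lemma coord_proj_bounded_ops: "coord_proj F \<in> bounded_ops"
  by (rule bounded_opsI) (simp add: coord_trunc_scaleC)

lemma coord_trunc_coord_trunc:
  "finite F \<Longrightarrow> finite G \<Longrightarrow> coord_trunc F (coord_trunc G f) = coord_trunc (F \<inter> G) f"
  by (rule ell2_eqI) (simp add: ell2_apply_coord_trunc)

lemma cinner_coord_trunc: "cinner (coord_trunc F f) g = cinner f (coord_trunc F g)"
  by (simp add: coord_trunc_def cinner_sum_left cinner_sum_right cinner_scaleC_left
      cinner_scaleC_right cinner_delta_left cinner_delta_right mult.commute)

lemma norm_diff_coord_trunc_le: "finite F \<Longrightarrow> norm (f - coord_trunc F f) \<le> norm f"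
  by (rule power2_le_imp_le) (simp_all add: norm_diff_coord_trunc sum_nonneg)

text \<open>The operators supported in one finite square block. Taking the same \<open>F\<close> for
  rows and columns lets two of them be moved into a common block by enlarging
  \<open>F\<close>.\<close>

definition finite_matrices :: "('a ell2 \<Rightarrow>\<^sub>L 'a ell2) set"
  where "finite_matrices = {T \<in> bounded_ops. \<exists>F. finite F \<and> coord_proj F o\<^sub>L T o\<^sub>L coord_proj F = T}"

lemma coord_proj_compose:
  "finite F \<Longrightarrow> finite G \<Longrightarrow> coord_proj F o\<^sub>L coord_proj G = coord_proj (F \<inter> G)"
  by (rule blinfun_eqI) (simp add: coord_trunc_coord_trunc)

lemma coord_proj_sandwich_mono:
  assumes "coord_proj F o\<^sub>L T o\<^sub>L coord_proj F = T" "finite F" "finite G" "F \<subseteq> G"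
  shows "coord_proj G o\<^sub>L T o\<^sub>L coord_proj G = T"
proof -
  have "coord_proj G o\<^sub>L T o\<^sub>L coord_proj G
      = (coord_proj G o\<^sub>L coord_proj F) o\<^sub>L T o\<^sub>L (coord_proj F o\<^sub>L coord_proj G)"
    by (subst (1) assms(1)[symmetric]) (simp add: blinfun_compose_assoc)
  also have "\<dots> = T"
    using assms by (simp add: coord_proj_compose Int_absorb1 Int_absorb2)
  finally show ?thesis .
qed

lemma finite_matrices_common:
  assumes "S \<in> finite_matrices" "T \<in> finite_matrices"
  obtains F where "finite F" "coord_proj F o\<^sub>L S o\<^sub>L coord_proj F = S"
    "coord_proj F o\<^sub>L T o\<^sub>L coord_proj F = T"
proof -
  obtain F G where "finite F" "coord_proj F o\<^sub>L S o\<^sub>L coord_proj F = S"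
    "finite G" "coord_proj G o\<^sub>L T o\<^sub>L coord_proj G = T"
    using assms by (auto simp: finite_matrices_def)
  then show ?thesis
    using that[of "F \<union> G"] coord_proj_sandwich_mono[of F S "F \<union> G"]
      coord_proj_sandwich_mono[of G T "F \<union> G"] by simp
qed

lemma zero_finite_matrices: "0 \<in> finite_matrices"
  by (auto simp: finite_matrices_def zero_bounded_ops intro!: exI[of _ "{}"] blinfun_eqI)

lemma add_finite_matrices:
  assumes "S \<in> finite_matrices" "T \<in> finite_matrices"
  shows "S + T \<in> finite_matrices"
proof -
  obtain F where "finite F" "coord_proj F o\<^sub>L S o\<^sub>L coord_proj F = S"
    "coord_proj F o\<^sub>L T o\<^sub>L coord_proj F = T"
    using finite_matrices_common[OF assms] by metis
  moreover have "S + T \<in> bounded_ops"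
    using assms by (simp add: finite_matrices_def add_bounded_ops)
  moreover have "coord_proj F o\<^sub>L (S + T) o\<^sub>L coord_proj F
      = (coord_proj F o\<^sub>L S o\<^sub>L coord_proj F) + (coord_proj F o\<^sub>L T o\<^sub>L coord_proj F)"
    by (simp add: blinfun_compose_add_left blinfun_compose_add_right)
  ultimately show ?thesis
    by (auto simp: finite_matrices_def)
qed

lemma scalar_finite_matrices:
  assumes "T \<in> finite_matrices"
  shows "scalar_op c o\<^sub>L T \<in> finite_matrices"
proof -
  obtain F where F: "finite F" "coord_proj F o\<^sub>L T o\<^sub>L coord_proj F = T" and T: "T \<in> bounded_ops"
    using assms by (auto simp: finite_matrices_def)
  have "coord_proj F o\<^sub>L (scalar_op c o\<^sub>L T) o\<^sub>L coord_proj F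
      = scalar_op c o\<^sub>L (coord_proj F o\<^sub>L T o\<^sub>L coord_proj F)"
    by (rule blinfun_eqI) (simp add: coord_trunc_scaleC)
  then show ?thesis
    using F T by (auto simp: finite_matrices_def compose_bounded_ops scalar_op_bounded_ops)
qed

lemma compose_finite_matrices:
  assumes "S \<in> finite_matrices" "T \<in> finite_matrices"
  shows "S o\<^sub>L T \<in> finite_matrices"
proof -
  obtain F where F: "finite F" and S: "coord_proj F o\<^sub>L S o\<^sub>L coord_proj F = S"
    and T: "coord_proj F o\<^sub>L T o\<^sub>L coord_proj F = T"
    using finite_matrices_common[OF assms] by metis
  have PP: "coord_proj F o\<^sub>L coord_proj F = coord_proj F"
    using F by (simp add: coord_proj_compose)
  have "coord_proj F o\<^sub>L S = S"
    by (metis S PP blinfun_compose_assoc)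
  moreover have "T o\<^sub>L coord_proj F = T"
    by (metis T PP blinfun_compose_assoc)
  ultimately have "coord_proj F o\<^sub>L (S o\<^sub>L T) o\<^sub>L coord_proj F = S o\<^sub>L T"
    by (metis blinfun_compose_assoc)
  then show ?thesis
    using F assms by (auto simp: finite_matrices_def compose_bounded_ops)
qed

lemma adj_coord_sandwich:
  assumes "T \<in> bounded_ops"
  shows "adj (coord_proj F o\<^sub>L T o\<^sub>L coord_proj F) = coord_proj F o\<^sub>L adj T o\<^sub>L coord_proj F"
  by (rule adj_eqI) (simp add: cinner_coord_trunc cinner_adj[OF assms])

lemma adj_finite_matrices: "T \<in> finite_matrices \<Longrightarrow> adj T \<in> finite_matrices"
  by (auto simp: finite_matrices_def adj_bounded_ops)
    (metis adj_coord_sandwich)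

lemma finite_matrices_subset:
  assumes A: "cstar_subalgebra A" and E: "\<And>x y. matrix_unit x y \<in> A"
  shows "finite_matrices \<subseteq> A"
proof
  fix T :: "'a ell2 \<Rightarrow>\<^sub>L 'a ell2"
  assume "T \<in> finite_matrices"
  then obtain F where T: "T \<in> bounded_ops" "coord_proj F o\<^sub>L T o\<^sub>L coord_proj F = T"
    by (auto simp: finite_matrices_def)
  have sum: "(\<Sum>i\<in>I. g i) \<in> A" if "\<And>i. g i \<in> A" for g :: "'a \<Rightarrow> 'a ell2 \<Rightarrow>\<^sub>L 'a ell2" and I
    using that A by (induction I rule: infinite_finite_induct) (simp_all add: cstar_subalgebra_def)
  \<comment> \<open>Both projections are expanded into diagonal matrix units; each summand is then a
    scalar times a matrix unit.\<close>
  have "T = (\<Sum>x\<in>F. \<Sum>y\<in>F. matrix_unit x x o\<^sub>L T o\<^sub>L matrix_unit y y)"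
    by (subst T(2)[symmetric]) (simp add: coord_proj_def blinfun_compose_sum_left blinfun_compose_sum_right,
        rule sum.swap)
  also have "\<dots> \<in> A"
    using A E by (auto intro!: sum simp: matrix_unit_sandwich[OF T(1)] cstar_subalgebra_def)
  finally show "T \<in> A" .
qed

section \<open>Compact operators as the norm closure of the finite matrices\<close>

lemma compact_box:
  assumes "finite F"
  shows "\<exists>C. compact C \<and> {\<Sum>x\<in>F. c x *\<^sub>C delta x | c. \<forall>x. cmod (c x) \<le> M} \<subseteq> C"
  using assms
proof induction
  case empty
  show ?case
    by (intro exI[of _ "{0}"]) auto
next
  case (insert x F)
  then obtain C where C: "compact C" "{\<Sum>x\<in>F. c x *\<^sub>C delta x | c. \<forall>x. cmod (c x) \<le> M} \<subseteq> C"
    by blast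
  \<comment> \<open>The box over \<open>insert x F\<close> lies in the image of a disc times the
    compact set for \<open>F\<close> under this continuous map.\<close>
  let ?h = "\<lambda>p. fst p *\<^sub>C delta x + snd p"
  have "compact (?h ` (cball 0 M \<times> C))"
    by (intro compact_continuous_image compact_Times compact_cball C continuous_on_add
        bounded_linear.continuous_on[OF bounded_linear_scaleC_left] continuous_intros)
  moreover have "(\<Sum>x\<in>insert x F. c x *\<^sub>C delta x) \<in> ?h ` (cball 0 M \<times> C)" if "\<forall>x. cmod (c x) \<le> M" for c
  proof -
    have "(\<Sum>x\<in>F. c x *\<^sub>C delta x) \<in> C"
      using C(2) that by blast
    then show ?thesis
      using insert that by (intro image_eqI[of _ _ "(c x, \<Sum>x\<in>F. c x *\<^sub>C delta x)"]) auto
  qed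
  ultimately show ?case
    by blast
qed

text \<open>A finite matrix sends the unit ball into a compact set, and a norm limit inherits total
  boundedness from its approximants.\<close>

lemma closure_finite_matrices_compact: "closure finite_matrices \<subseteq> compact_ops"
proof
  fix S :: "'a ell2 \<Rightarrow>\<^sub>L 'a ell2"
  assume S: "S \<in> closure finite_matrices"
  have "closure finite_matrices \<subseteq> (bounded_ops :: ('a ell2 \<Rightarrow>\<^sub>L 'a ell2) set)"
    by (rule closure_minimal) (auto simp: finite_matrices_def closed_bounded_ops)
  with S have "S \<in> bounded_ops"
    by blast
  moreover have "compact (closure (blinfun_apply S ` cball 0 1))"
    unfolding compact_eq_totally_bounded
  proof (intro conjI allI impI)
    show "complete (closure (blinfun_apply S ` cball 0 1))"
      by (simp add: complete_eq_closed)
    fix e :: real assume e: "e > 0"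
    \<comment> \<open>Three errors below \<open>e/4\<close> will occur: from \<open>g\<close> to
      \<open>S f\<close>, from \<open>S f\<close> to \<open>R f\<close>, and from \<open>R f\<close>
      to a net point.\<close>
    then obtain R where R: "R \<in> finite_matrices" "dist R S < e/4"
      using S unfolding closure_approachable by (meson divide_pos_pos zero_less_numeral)
    obtain F where F: "finite F" "coord_proj F o\<^sub>L R o\<^sub>L coord_proj F = R"
      using R by (auto simp: finite_matrices_def)
    obtain C where C: "compact C" "{\<Sum>x\<in>F. c x *\<^sub>C delta x | c. \<forall>x. cmod (c x) \<le> norm R} \<subseteq> C"
      using compact_box[OF F(1)] by blast
    have RC: "blinfun_apply R f \<in> C" if "norm f \<le> 1" for f
    proof -
      have "coord_proj F o\<^sub>L R = R"
        using F by (metis blinfun_compose_assoc coord_proj_compose inf.idem)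
      then have "blinfun_apply R f = coord_trunc F (blinfun_apply R f)"
        by (metis blinfun_apply_blinfun_compose coord_proj_apply)
      also have "\<dots> \<in> C"
      proof -
        have "norm (blinfun_apply R f) \<le> norm R"
          using norm_blinfun[of R f] that mult_left_le[of "norm f" "norm R"] by simp
        then have "\<forall>x. cmod (ell2_apply (blinfun_apply R f) x) \<le> norm R"
          by (meson cmod_ell2_apply_le order_trans)
        then show ?thesis
          unfolding coord_trunc_def
            by (intro subsetD[OF C(2)] CollectI exI[of _ "ell2_apply (blinfun_apply R f)"] conjI refl)
      qed
      finally show ?thesis .
    qed
    obtain k where k: "finite k" "C \<subseteq> (\<Union>z\<in>k. ball z (e/4))"
      using C(1) e unfolding compact_eq_totally_bounded by (meson divide_pos_pos zero_less_numeral)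
    have "closure (blinfun_apply S ` cball 0 1) \<subseteq> (\<Union>z\<in>k. ball z e)"
    proof
      fix g assume "g \<in> closure (blinfun_apply S ` cball 0 1)"
      then obtain f where f: "norm f \<le> 1" "dist (blinfun_apply S f) g < e/4"
        using e unfolding closure_approachable by (force dest: spec[of _ "e/4"])
      obtain z where z: "z \<in> k" "dist z (blinfun_apply R f) < e/4"
        using RC[OF f(1)] k(2) by auto
      have "norm (blinfun_apply (R - S) f) \<le> norm (R - S)"
        using norm_blinfun[of "R - S" f] f mult_left_le[of "norm f" "norm (R - S)"] by simp
      then have "dist (blinfun_apply R f) (blinfun_apply S f) < e/4"
        using R(2) by (simp add: dist_norm blinfun.diff_left)
      then have "dist z g < e"
        using f(2) z(2) dist_triangle[of z g "blinfun_apply R f"]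
          dist_triangle[of "blinfun_apply R f" g "blinfun_apply S f"] e by linarith
      then show "g \<in> (\<Union>z\<in>k. ball z e)"
        using z(1) by auto
    qed
    then show "\<exists>k. finite k \<and> closure (blinfun_apply S ` cball 0 1) \<subseteq> (\<Union>z\<in>k. ball z e)"
      using k(1) by blast
  qed
  ultimately show "S \<in> compact_ops"
    by (simp add: compact_ops_def)
qed

text \<open>A single truncation is made close to the identity on a finite net of the image of the
  unit ball; as the complementary projection is contractive, it stays close on the whole
  image.\<close>

lemma compact_finite_rank_approx:
  assumes T: "T \<in> compact_ops" and e: "0 < e"
  obtains F where "finite F" "norm (T - (coord_proj F o\<^sub>L T)) \<le> e"
proof -
  obtain k where k: "finite k" "closure (blinfun_apply T ` cball 0 1) \<subseteq> (\<Union>z\<in>k. ball z (e/2))"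
    using T e unfolding compact_ops_def compact_eq_totally_bounded mem_Collect_eq
    by (meson half_gt_zero)
  have "eventually (\<lambda>F. finite F \<and> (\<forall>z\<in>k. norm (z - coord_trunc F z) < e/2)) (finite_subsets_at_top UNIV)"
    using k(1) e by (intro eventually_conj eventually_ball_finite ballI eventually_norm_diff_coord_trunc)
      (simp_all add: eventually_finite_subsets_at_top_weakI)
  from eventually_happens'[OF finite_subsets_at_top_neq_bot this]
  obtain F where F: "finite F" "\<And>z. z \<in> k \<Longrightarrow> norm (z - coord_trunc F z) < e/2"
    by (elim exE conjE) (auto intro: that)
  have "norm (T - (coord_proj F o\<^sub>L T)) \<le> e"
  proof (rule norm_blinfun_le_unit_ball)
    fix f :: "'a ell2" assume "norm f \<le> 1"
    then have "blinfun_apply T f \<in> closure (blinfun_apply T ` cball 0 1)"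
      by (intro closure_subset[THEN subsetD]) simp
    then obtain z where z: "z \<in> k" "norm (z - blinfun_apply T f) < e/2"
      using k(2) by (auto simp: dist_norm)
    define g where "g = blinfun_apply T f - z"
    have "blinfun_apply T f = g + z"
      by (simp add: g_def)
    then have "blinfun_apply (T - (coord_proj F o\<^sub>L T)) f = (g - coord_trunc F g) + (z - coord_trunc F z)"
      using blinfun.add_right[of "coord_proj F" g z] by (simp add: blinfun.diff_left)
    also have "norm \<dots> \<le> norm (g - coord_trunc F g) + norm (z - coord_trunc F z)"
      by (rule norm_triangle_ineq)
    also have "\<dots> \<le> norm g + e/2"
      using norm_diff_coord_trunc_le[OF F(1)] F(2)[OF z(1)] by (simp add: add_mono less_imp_le)
    also have "\<dots> \<le> e"
      using z(2) by (simp add: g_def norm_minus_commute)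
    finally show "norm (blinfun_apply (T - (coord_proj F o\<^sub>L T)) f) \<le> e" .
  qed
  with F(1) that show ?thesis
    by blast
qed

text \<open>The rows of \<open>T\<close> in \<open>F\<close> are given by the finitely many vectors
  \<open>adj T (delta x)\<close>; truncating all of them to a large \<open>G\<close> changes the
  operator little.\<close>

lemma finite_rank_corner_approx:
  assumes T: "T \<in> bounded_ops" and F: "finite F" and e: "0 < e"
  obtains G where "finite G" "F \<subseteq> G"
    "norm ((coord_proj F o\<^sub>L T) - (coord_proj F o\<^sub>L T o\<^sub>L coord_proj G)) \<le> e"
proof -
  define h where "h x = blinfun_apply (adj T) (delta x)" for x
  \<comment> \<open>The added 1 keeps the denominator nonzero when \<open>F\<close> is empty; the
    errors of the \<open>card F\<close> rows still sum to at most \<open>e\<close>.\<close>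
  define d where "d = e / (card F + 1)"
  have d: "d > 0"
    using e by (simp add: d_def)
  have "eventually (\<lambda>G. (finite G \<and> F \<subseteq> G) \<and> (\<forall>x\<in>F. norm (h x - coord_trunc G (h x)) < d)) (finite_subsets_at_top UNIV)"
    using F d by (intro eventually_conj eventually_ball_finite ballI eventually_norm_diff_coord_trunc)
      (auto simp: eventually_finite_subsets_at_top)
  from eventually_happens'[OF finite_subsets_at_top_neq_bot this]
  obtain G where G: "finite G" "F \<subseteq> G" "\<And>x. x \<in> F \<Longrightarrow> norm (h x - coord_trunc G (h x)) < d"
    by (elim exE conjE) (auto intro: that)
  have "norm ((coord_proj F o\<^sub>L T) - (coord_proj F o\<^sub>L T o\<^sub>L coord_proj G)) \<le> e"
  proof (rule norm_blinfun_le_unit_ball)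
    fix f :: "'a ell2" assume f: "norm f \<le> 1"
    let ?g = "blinfun_apply T (f - coord_trunc G f)"
    have "cmod (ell2_apply ?g x) \<le> d" if "x \<in> F" for x
    proof -
      have "ell2_apply ?g x = cinner (delta x) ?g"
        by (simp add: cinner_delta_left)
      also have "\<dots> = cinner (h x) (f - coord_trunc G f)"
        unfolding h_def by (metis T cinner_adj cinner_commute)
      also have "\<dots> = cinner (h x - coord_trunc G (h x)) f"
        by (simp add: cinner_diff_left cinner_diff_right cinner_coord_trunc)
      finally have "cmod (ell2_apply ?g x) \<le> norm (h x - coord_trunc G (h x)) * norm f"
        using norm_cinner_le by metis
      also have "\<dots> \<le> d * 1"
        using G(3)[OF that] f d by (intro mult_mono) auto
      finally show ?thesis
        by simp
    qed
    then have "norm (coord_trunc F ?g) \<le> (\<Sum>x\<in>F. d)"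
      unfolding coord_trunc_def by (intro sum_norm_le) (simp add: norm_scaleC)
    also have "\<dots> \<le> e"
      using e by (simp add: d_def field_simps)
    finally have "norm (coord_trunc F ?g) \<le> e" .
    moreover have "blinfun_apply ((coord_proj F o\<^sub>L T) - (coord_proj F o\<^sub>L T o\<^sub>L coord_proj G)) f
        = blinfun_apply (coord_proj F) ?g"
      by (simp only: blinfun.diff_left blinfun.diff_right blinfun_apply_blinfun_compose coord_proj_apply)
    ultimately show "norm (blinfun_apply ((coord_proj F o\<^sub>L T) - (coord_proj F o\<^sub>L T o\<^sub>L coord_proj G)) f) \<le> e"
      by simp
  qed
  with G that show ?thesis
    by blast
qed

lemma compact_ops_eq_closure: "compact_ops = closure finite_matrices"
proof
  show "closure finite_matrices \<subseteq> (compact_ops :: ('a ell2 \<Rightarrow>\<^sub>L 'a ell2) set)"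
    by (rule closure_finite_matrices_compact)
  show "compact_ops \<subseteq> (closure finite_matrices :: ('a ell2 \<Rightarrow>\<^sub>L 'a ell2) set)"
  proof
    fix T :: "'a ell2 \<Rightarrow>\<^sub>L 'a ell2"
    assume T: "T \<in> compact_ops"
    then have Tb: "T \<in> bounded_ops"
      by (simp add: compact_ops_def)
    show "T \<in> closure finite_matrices"
      unfolding closure_approachable
    proof (intro allI impI)
      fix e :: real assume e: "e > 0"
      obtain F where F: "finite F" "norm (T - (coord_proj F o\<^sub>L T)) \<le> e/3"
        using compact_finite_rank_approx[OF T, of "e/3"] e by auto
      obtain G where G: "finite G" "F \<subseteq> G"
        "norm ((coord_proj F o\<^sub>L T) - (coord_proj F o\<^sub>L T o\<^sub>L coord_proj G)) \<le> e/3"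
        using finite_rank_corner_approx[OF Tb F(1), of "e/3"] e by auto
      let ?R = "coord_proj F o\<^sub>L T o\<^sub>L coord_proj G"
      \<comment> \<open>Because \<open>F \<subseteq> G\<close>, the rectangular block with rows
        \<open>F\<close> and columns \<open>G\<close> lies in the square block of
        \<open>G\<close>.\<close>
      have "coord_proj G o\<^sub>L ?R o\<^sub>L coord_proj G
          = (coord_proj G o\<^sub>L coord_proj F) o\<^sub>L T o\<^sub>L (coord_proj G o\<^sub>L coord_proj G)"
        by (simp add: blinfun_compose_assoc)
      then have "coord_proj G o\<^sub>L ?R o\<^sub>L coord_proj G = ?R"
        using F(1) G(1,2) by (simp add: coord_proj_compose Int_absorb1)
      then have "?R \<in> finite_matrices"
        using G(1) Tb by (auto simp: finite_matrices_def compose_bounded_ops coord_proj_bounded_ops)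
      moreover have "norm (T - ?R) \<le> norm (T - (coord_proj F o\<^sub>L T)) + norm ((coord_proj F o\<^sub>L T) - ?R)"
        using norm_triangle_ineq[of "T - (coord_proj F o\<^sub>L T)" "(coord_proj F o\<^sub>L T) - ?R"] by simp
      then have "dist ?R T < e"
        using F(2) G(3) e by (simp add: dist_norm norm_minus_commute)
      ultimately show "\<exists>R\<in>finite_matrices. dist R T < e"
        by blast
    qed
  qed
qed

section \<open>Closure properties of the compact operators\<close>

lemma compact_ops_bounded: "T \<in> compact_ops \<Longrightarrow> T \<in> bounded_ops"
  by (simp add: compact_ops_def)

lemma closed_compact_ops: "closed compact_ops"
  by (simp add: compact_ops_eq_closure)

lemma finite_matrices_compact: "T \<in> finite_matrices \<Longrightarrow> T \<in> compact_ops"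
  unfolding compact_ops_eq_closure by (rule closure_subset[THEN subsetD])

text \<open>Separate continuity suffices: first the second argument runs over the closure while the
  first is a finite matrix, then the first argument does.\<close>

lemma compact_ops_binary:
  assumes cont: "\<And>T. continuous_on UNIV (\<lambda>S. h S T)" "\<And>S. continuous_on UNIV (h S)"
    and fin: "\<And>S T. S \<in> finite_matrices \<Longrightarrow> T \<in> finite_matrices \<Longrightarrow> h S T \<in> finite_matrices"
    and S: "S \<in> compact_ops" and T: "T \<in> compact_ops"
  shows "h S T \<in> compact_ops"
proof -
  have 1: "h R T \<in> compact_ops" if "R \<in> finite_matrices" for R
  proof -
    have "h R ` closure finite_matrices \<subseteq> compact_ops"
      using fin[OF that] finite_matrices_compact closed_compact_ops
      by (intro image_closure_subset continuous_on_subset[OF cont(2)]) auto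
    then show ?thesis
      using T unfolding compact_ops_eq_closure by blast
  qed
  have "(\<lambda>S. h S T) ` closure finite_matrices \<subseteq> compact_ops"
    using 1 closed_compact_ops
    by (intro image_closure_subset continuous_on_subset[OF cont(1)]) auto
  then show ?thesis
    using S unfolding compact_ops_eq_closure by blast
qed

lemma add_compact_ops: "S \<in> compact_ops \<Longrightarrow> T \<in> compact_ops \<Longrightarrow> S + T \<in> compact_ops"
  by (rule compact_ops_binary[where h = "(+)"])
    (auto intro!: continuous_intros add_finite_matrices)

lemma compose_compact_ops: "S \<in> compact_ops \<Longrightarrow> T \<in> compact_ops \<Longrightarrow> S o\<^sub>L T \<in> compact_ops"
  by (rule compact_ops_binary[where h = "(o\<^sub>L)"])
    (auto intro!: compose_finite_matrices linear_continuous_on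
      bounded_bilinear.bounded_linear_left[OF bounded_bilinear_blinfun_compose]
      bounded_bilinear.bounded_linear_right[OF bounded_bilinear_blinfun_compose])

lemma scalar_compact_ops: "T \<in> compact_ops \<Longrightarrow> scalar_op c o\<^sub>L T \<in> compact_ops"
  \<comment> \<open>The unary operation is treated as a binary one that is constant in its second
    argument.\<close>
  by (rule compact_ops_binary[where h = "\<lambda>S T. scalar_op c o\<^sub>L S" and S = T and T = T])
    (auto intro!: scalar_finite_matrices linear_continuous_on
      bounded_bilinear.bounded_linear_right[OF bounded_bilinear_blinfun_compose])

lemma zero_compact_ops: "0 \<in> compact_ops"
  by (rule finite_matrices_compact[OF zero_finite_matrices])

lemma matrix_unit_finite_matrices: "matrix_unit x y \<in> finite_matrices"
proof -
  have "coord_proj {x, y} o\<^sub>L matrix_unit x y o\<^sub>L coord_proj {x, y} = matrix_unit x y"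
    by (intro blinfun_eqI ell2_eqI) (simp add: ell2_apply_coord_trunc scaleC.rep_eq delta.rep_eq)
  then show ?thesis
    by (auto simp: finite_matrices_def matrix_unit_bounded_ops intro!: exI[of _ "{x, y}"])
qed

lemma adj_diff:
  assumes "S \<in> bounded_ops" "T \<in> bounded_ops"
  shows "adj (S - T) = adj S - adj T"
  by (rule adj_eqI)
    (simp add: blinfun.diff_left cinner_diff_left cinner_diff_right cinner_adj[OF assms(1)] cinner_adj[OF assms(2)])

text \<open>Taking adjoints is contractive on complex-linear operators and preserves finite
  matrices, hence it preserves their closure.\<close>

lemma adj_compact_ops:
  assumes S: "S \<in> compact_ops"
  shows "adj S \<in> compact_ops"
  unfolding compact_ops_eq_closure closure_approachable
proof (intro allI impI)
  fix e :: real assume "e > 0"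
  then obtain R where R: "R \<in> finite_matrices" "dist R S < e"
    using S unfolding compact_ops_eq_closure closure_approachable by blast
  have Rb: "R \<in> bounded_ops" and Sb: "S \<in> bounded_ops"
    using R(1) S by (simp_all add: finite_matrices_def compact_ops_bounded)
  have "dist (adj R) (adj S) < e"
    using norm_adj_le[OF diff_bounded_ops[OF Rb Sb]] R(2) by (simp add: dist_norm adj_diff[OF Rb Sb])
  then show "\<exists>T\<in>finite_matrices. dist T (adj S) < e"
    using adj_finite_matrices[OF R(1)] by blast
qed

text \<open>\<open>K\<close> is small on all but finitely many basis vectors, where \<open>K + c\<close> is then close to \<open>c\<close>.\<close>

lemma norm_scalar_le_compact_plus_scalar:
  fixes K :: "'a ell2 \<Rightarrow>\<^sub>L 'a ell2"
  assumes inf: "infinite (UNIV :: 'a set)" and K: "K \<in> compact_ops"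
  shows "cmod c \<le> norm (K + scalar_op c)"
proof (rule field_le_epsilon)
  fix e :: real assume "e > 0"
  then obtain R where R: "R \<in> finite_matrices" "dist R K < e"
    using K unfolding compact_ops_eq_closure closure_approachable by blast
  then obtain F where F: "finite F" "coord_proj F o\<^sub>L R o\<^sub>L coord_proj F = R"
    by (auto simp: finite_matrices_def)
  obtain x where x: "x \<notin> F"
    using ex_new_if_finite[OF inf F(1)] by blast
  have "coord_trunc F (delta x) = 0"
    using x F(1) by (intro ell2_eqI) (auto simp: ell2_apply_coord_trunc delta.rep_eq zero_ell2.rep_eq)
  then have "blinfun_apply R (delta x) = 0"
    by (metis F(2) blinfun_apply_blinfun_compose blinfun.zero_right coord_proj_apply)
  then have "c *\<^sub>C delta x = blinfun_apply (K + scalar_op c) (delta x) + blinfun_apply (R - K) (delta x)"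
    by (simp add: blinfun.add_left blinfun.diff_left)
  then have "cmod c \<le> norm (blinfun_apply (K + scalar_op c) (delta x)) + norm (blinfun_apply (R - K) (delta x))"
    using norm_triangle_ineq by (metis norm_scaleC norm_delta mult.right_neutral)
  also have "\<dots> \<le> norm (K + scalar_op c) + norm (R - K)"
    using norm_blinfun[of "K + scalar_op c" "delta x"] norm_blinfun[of "R - K" "delta x"] by simp
  also have "\<dots> \<le> norm (K + scalar_op c) + e"
    using R(2) by (simp add: dist_norm)
  finally show "cmod c \<le> norm (K + scalar_op c) + e" .
qed

section \<open>The unitised compacts as a C*-algebra\<close>

lemma scalar_op_diff: "scalar_op (a - b) = scalar_op a - scalar_op b"
  by (rule blinfun_eqI) (simp add: blinfun.diff_left scaleC_diff_left)

lemma scalar_op_add: "scalar_op (a + b) = scalar_op a + scalar_op b"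
  by (rule blinfun_eqI) (simp add: blinfun.add_left scaleC_add_left)

lemma norm_scalar_op_le: "norm (scalar_op c) \<le> cmod c"
  by (rule norm_blinfun_bound) (simp_all add: norm_scaleC)

lemma diff_compact_ops:
  assumes "S \<in> compact_ops" "T \<in> compact_ops"
  shows "S - T \<in> compact_ops"
proof -
  have eq: "S - T = S + (scalar_op (- 1) o\<^sub>L T)"
    by (rule blinfun_eqI) (simp add: blinfun.diff_left blinfun.add_left scaleC_minus_one)
  show ?thesis
    unfolding eq by (intro add_compact_ops scalar_compact_ops assms)
qed

lemma unitised_compactsI: "K \<in> compact_ops \<Longrightarrow> K + scalar_op c \<in> unitised_compacts"
  by (auto simp: unitised_compacts_def)

text \<open>On an infinite index set the scalar part depends contractively on the operator, so the
  scalar parts of a convergent sequence converge; removing them leaves a convergent sequence of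
  compact operators.\<close>

lemma closed_unitised_compacts:
  assumes inf: "infinite (UNIV :: 'a set)"
  shows "closed (unitised_compacts :: ('a ell2 \<Rightarrow>\<^sub>L 'a ell2) set)"
  unfolding closed_sequential_limits
proof (intro allI impI, elim conjE)
  fix X and T :: "'a ell2 \<Rightarrow>\<^sub>L 'a ell2"
  assume X: "\<forall>n. X n \<in> unitised_compacts" and lim: "X \<longlonglongrightarrow> T"
  have "\<exists>K c. K \<in> compact_ops \<and> X n = K + scalar_op c" for n
    using spec[OF X, of n] unfolding unitised_compacts_def by blast
  then obtain K c where K: "\<And>n. K n \<in> compact_ops" and XK: "\<And>n. X n = K n + scalar_op (c n)"
    by metis
  have "dist (c m) (c n) \<le> dist (X m) (X n)" for m n
  proof -
    have "X m - X n = (K m - K n) + scalar_op (c m - c n)"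
      by (simp add: XK scalar_op_diff)
    then show ?thesis
      using norm_scalar_le_compact_plus_scalar[OF inf diff_compact_ops[OF K K], of "c m - c n" m n]
      by (simp add: dist_norm)
  qed
  then have "Cauchy c"
    using LIMSEQ_imp_Cauchy[OF lim] unfolding Cauchy_def by (meson le_less_trans)
  then obtain a where a: "c \<longlonglongrightarrow> a"
    by (auto simp: Cauchy_convergent_iff convergent_def)
  have "(\<lambda>n. scalar_op (c n) :: 'a ell2 \<Rightarrow>\<^sub>L 'a ell2) \<longlonglongrightarrow> scalar_op a"
  proof (rule Lim_transform_bound[where g = "\<lambda>n. c n - a", THEN LIM_zero_cancel])
    show "eventually (\<lambda>n. norm (scalar_op (c n) - scalar_op a :: 'a ell2 \<Rightarrow>\<^sub>L 'a ell2) \<le> norm (c n - a)) sequentially"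
      by (simp add: norm_scalar_op_le flip: scalar_op_diff)
    show "(\<lambda>n. c n - a) \<longlonglongrightarrow> 0"
      using a by (simp add: LIM_zero)
  qed
  then have "(\<lambda>n. X n - scalar_op (c n)) \<longlonglongrightarrow> T - scalar_op a"
    by (intro tendsto_diff lim)
  then have "K \<longlonglongrightarrow> T - scalar_op a"
    by (simp add: XK)
  then have "T - scalar_op a \<in> compact_ops"
    using K closed_compact_ops unfolding closed_sequential_limits by blast
  from unitised_compactsI[OF this, of a] show "T \<in> unitised_compacts"
    by simp
qed

lemma unitised_compacts_bounded: "T \<in> unitised_compacts \<Longrightarrow> T \<in> bounded_ops"
  by (auto simp: unitised_compacts_def compact_ops_bounded add_bounded_ops scalar_op_bounded_ops)

lemma compact_ops_unitised: "K \<in> compact_ops \<Longrightarrow> K \<in> unitised_compacts"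
proof -
  have "scalar_op 0 = 0"
    by (rule blinfun_eqI) simp
  then show "K \<in> compact_ops \<Longrightarrow> K \<in> unitised_compacts"
    using unitised_compactsI[of K 0] by (metis add.right_neutral)
qed

lemma cstar_subalgebra_unitised_compacts:
  assumes "infinite (UNIV :: 'a set)"
  shows "cstar_subalgebra (unitised_compacts :: ('a ell2 \<Rightarrow>\<^sub>L 'a ell2) set)"
  unfolding cstar_subalgebra_def
proof (intro conjI ballI allI)
  show "(unitised_compacts :: ('a ell2 \<Rightarrow>\<^sub>L 'a ell2) set) \<subseteq> bounded_ops"
    using unitised_compacts_bounded by blast
  show "0 \<in> unitised_compacts"
    by (simp add: compact_ops_unitised zero_compact_ops)
  show "closed (unitised_compacts :: ('a ell2 \<Rightarrow>\<^sub>L 'a ell2) set)"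
    using assms by (rule closed_unitised_compacts)
  fix S :: "'a ell2 \<Rightarrow>\<^sub>L 'a ell2"
  assume "S \<in> unitised_compacts"
  then obtain K a where K: "K \<in> compact_ops" and S: "S = K + scalar_op a"
    by (auto simp: unitised_compacts_def)
  have "adj S = adj K + scalar_op (cnj a)"
    by (rule adj_eqI) (simp add: S blinfun.add_left cinner_add_left cinner_add_right
        cinner_scaleC_left cinner_scaleC_right cinner_adj[OF compact_ops_bounded[OF K]])
  then show "adj S \<in> unitised_compacts"
    by (simp add: K adj_compact_ops unitised_compactsI)
  have "scalar_op c o\<^sub>L S = (scalar_op c o\<^sub>L K) + scalar_op (c * a)" for c
    by (rule blinfun_eqI) (simp add: S blinfun.add_left scaleC_add_right scaleC_scaleC)
  then show "scalar_op c o\<^sub>L S \<in> unitised_compacts" for c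
    by (simp add: K scalar_compact_ops unitised_compactsI)
  fix T :: "'a ell2 \<Rightarrow>\<^sub>L 'a ell2"
  assume "T \<in> unitised_compacts"
  then obtain L b where L: "L \<in> compact_ops" and T: "T = L + scalar_op b"
    by (auto simp: unitised_compacts_def)
  have "S + T = (K + L) + scalar_op (a + b)"
    by (simp add: S T scalar_op_add)
  then show "S + T \<in> unitised_compacts"
    using unitised_compactsI[OF add_compact_ops[OF K L]] by metis
  have "S o\<^sub>L T = ((K o\<^sub>L L) + (scalar_op b o\<^sub>L K) + (scalar_op a o\<^sub>L L)) + scalar_op (a * b)"
    by (rule blinfun_eqI) (simp add: S T blinfun.add_left blinfun.add_right scaleC_add_right
        scaleC_scaleC bounded_ops_scaleC[OF compact_ops_bounded[OF K]] add_ac)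
  then show "S o\<^sub>L T \<in> unitised_compacts"
    by (simp add: K L unitised_compactsI add_compact_ops compose_compact_ops scalar_compact_ops)
qed

lemma compact_ops_subset:
  assumes "cstar_subalgebra A" and "\<And>x y. matrix_unit x y \<in> A"
  shows "compact_ops \<subseteq> A"
  unfolding compact_ops_eq_closure
  using finite_matrices_subset[OF assms] assms(1)
  by (intro closure_minimal) (auto simp: cstar_subalgebra_def)

lemma unitised_compacts_subset:
  assumes A: "cstar_subalgebra A" and "\<And>x y. matrix_unit x y \<in> A" and one: "id_blinfun \<in> A"
  shows "unitised_compacts \<subseteq> A"
proof
  fix T :: "'a ell2 \<Rightarrow>\<^sub>L 'a ell2"
  assume "T \<in> unitised_compacts"
  then obtain K c where "K \<in> compact_ops" "T = K + scalar_op c"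
    by (auto simp: unitised_compacts_def)
  moreover have "scalar_op c = scalar_op c o\<^sub>L id_blinfun"
    by (rule blinfun_eqI) simp
  then have "scalar_op c \<in> A"
    using A one by (metis cstar_subalgebra_def)
  ultimately show "T \<in> A"
    using compact_ops_subset[OF assms(1,2)] A by (auto simp: cstar_subalgebra_def)
qed

text \<open>The images of two distinct \<open>v i\<close> are at distance
  \<open>sqrt 2 * cmod c\<close>. For nonzero \<open>c\<close>, infinitely many such points cannot
  lie in the totally bounded image of the unit ball.\<close>

lemma compact_eigenvalue_zero:
  assumes K: "K \<in> compact_ops" and I: "infinite I"
    and norm1: "\<And>i. i \<in> I \<Longrightarrow> norm (v i) = 1"
    and orth: "\<And>i j. i \<in> I \<Longrightarrow> j \<in> I \<Longrightarrow> i \<noteq> j \<Longrightarrow> cinner (v i) (v j) = 0"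
    and eig: "\<And>i. i \<in> I \<Longrightarrow> blinfun_apply K (v i) = c *\<^sub>C v i"
  shows "c = 0"
proof (rule ccontr)
  assume c: "c \<noteq> 0"
  obtain k where k: "finite k" "closure (blinfun_apply K ` cball 0 1) \<subseteq> (\<Union>z\<in>k. ball z (cmod c / 2))"
    using K c unfolding compact_ops_def compact_eq_totally_bounded mem_Collect_eq
    by (meson half_gt_zero zero_less_norm_iff)
  have "\<exists>z\<in>k. dist z (c *\<^sub>C v i) < cmod c / 2" if "i \<in> I" for i
  proof -
    have "blinfun_apply K (v i) \<in> closure (blinfun_apply K ` cball 0 1)"
      using norm1[OF that] by (intro closure_subset[THEN subsetD]) auto
    then show ?thesis
      using k(2) unfolding eig[OF that] by (meson UN_E mem_ball subsetD)
  qed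
  then obtain z where z: "\<And>i. i \<in> I \<Longrightarrow> z i \<in> k" "\<And>i. i \<in> I \<Longrightarrow> dist (z i) (c *\<^sub>C v i) < cmod c / 2"
    by metis
  \<comment> \<open>Pigeonhole: infinitely many indices share finitely many net points, so two of
    the images come within \<open>cmod c\<close> of each other.\<close>
  have "\<not> inj_on z I"
    using I k(1) z(1) by (meson finite_subset image_subsetI finite_imageD)
  then obtain i j where ij: "i \<in> I" "j \<in> I" "i \<noteq> j" "z i = z j"
    by (auto simp: inj_on_def)
  have "dist (c *\<^sub>C v i) (c *\<^sub>C v j) < cmod c"
    using z(2)[OF ij(1)] z(2)[OF ij(2)] ij(4) dist_triangle3[of "c *\<^sub>C v i" "c *\<^sub>C v j" "z i"] by simp
  then have "cmod c * norm (v i - v j) < cmod c"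
    by (simp add: dist_norm norm_scaleC flip: scaleC_diff_right)
  then have "norm (v i - v j) < 1"
    using c by simp
  moreover have "cinner (v i - v j) (v i - v j) = 2"
    using orth[OF ij(1,2,3)] orth[OF ij(2,1)] ij norm1
    by (simp add: cinner_diff_left cinner_diff_right cinner_self[of "v i"] cinner_self[of "v j"])
  then have "(norm (v i - v j))\<^sup>2 = 2"
    unfolding cinner_self by (metis of_real_eq_iff of_real_numeral)
  ultimately show False
    by (smt (verit) norm_ge_zero power_le_one)
qed

text \<open>Each eigenvalue on an infinite orthonormal family equals the scalar part of \<open>T\<close>.\<close>

lemma not_unitised_compacts:
  assumes I: "infinite I" "infinite J"
    and norm1: "\<And>i. norm (v i) = 1"
    and orth: "\<And>i j. i \<noteq> j \<Longrightarrow> cinner (v i) (v j) = 0"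
    and eig1: "\<And>i. i \<in> I \<Longrightarrow> blinfun_apply T (v i) = v i"
    and eig0: "\<And>i. i \<in> J \<Longrightarrow> blinfun_apply T (v i) = 0"
  shows "T \<notin> unitised_compacts"
proof
  assume "T \<in> unitised_compacts"
  then obtain K c where K: "K \<in> compact_ops" and T: "T = K + scalar_op c"
    by (auto simp: unitised_compacts_def)
  have Kv: "blinfun_apply K (v i) = blinfun_apply T (v i) - c *\<^sub>C v i" for i
    by (simp add: T blinfun.add_left)
  have "1 - c = 0"
    by (rule compact_eigenvalue_zero[OF K I(1), of v])
      (simp_all add: norm1 orth Kv eig1 scaleC_diff_left)
  moreover have "- c = 0"
    by (rule compact_eigenvalue_zero[OF K I(2), of v])
      (simp_all add: norm1 orth Kv eig0 scaleC_minus_left)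
  ultimately show False
    by simp
qed

section \<open>Partial translations\<close>

lemma ell2_apply_partial_translation:
  assumes "incl y = incl x + n"
  shows "ell2_apply (blinfun_apply (partial_translation n) f) y = ell2_apply f x"
proof -
  have "incl y - n = incl x"
    using assms by simp
  then show ?thesis
    by (simp add: partial_translation.rep_eq ptrans_fun.rep_eq inv_f_f[OF inj_incl])
qed

lemma ell2_apply_partial_translation_zero:
  fixes y :: "'a::int_subset"
  assumes "incl y - n \<notin> range (incl :: 'a \<Rightarrow> int)"
  shows "ell2_apply (blinfun_apply (partial_translation n) f) y = 0"
  using assms by (simp add: partial_translation.rep_eq ptrans_fun.rep_eq)

lemma partial_translation_bounded_ops: "partial_translation n \<in> bounded_ops"
  by (intro bounded_opsI ell2_eqI)
    (simp add: partial_translation.rep_eq ptrans_fun.rep_eq scaleC.rep_eq)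

lemma partial_translation_zero: "partial_translation 0 = id_blinfun"
  by (intro blinfun_eqI ell2_eqI) (simp add: ell2_apply_partial_translation)

definition translation_domain :: "int \<Rightarrow> 'a::int_subset set"
  where "translation_domain n = {x. incl x + n \<in> range (incl :: 'a \<Rightarrow> int)}"

text \<open>As the translation by \<open>- n\<close> is the adjoint of the translation by
  \<open>n\<close>, this product is the initial projection of that partial isometry.\<close>

definition translation_support :: "int \<Rightarrow> 'a::int_subset ell2 \<Rightarrow>\<^sub>L 'a ell2"
  where "translation_support n = partial_translation (- n) o\<^sub>L partial_translation n"

lemma ell2_apply_translation_support:
  fixes x :: "'a::int_subset"
  shows "ell2_apply (blinfun_apply (translation_support n) f) x
    = (if x \<in> translation_domain n then ell2_apply f x else 0)"
proof (cases "x \<in> translation_domain n")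
  case True
  then obtain y :: 'a where "incl y = incl x + n"
    unfolding translation_domain_def by (metis mem_Collect_eq rangeE)
  then show ?thesis
    using True by (simp add: translation_support_def ell2_apply_partial_translation[of x y "- n"]
        ell2_apply_partial_translation[of y x n])
next
  case False
  then show ?thesis
    by (simp add: translation_support_def translation_domain_def ell2_apply_partial_translation_zero)
qed

text \<open>Records the diagonal entries of the projection as equations between products, a form
  that an algebra isomorphism transports.\<close>

lemma translation_support_matrix_unit:
  "translation_support n o\<^sub>L matrix_unit x x = (if x \<in> translation_domain n then matrix_unit x x else 0)"
  by (intro blinfun_eqI ell2_eqI)
    (auto simp: ell2_apply_translation_support scaleC.rep_eq delta.rep_eq zero_ell2.rep_eq)

text \<open>The range of the translation is a translate of its domain and hence finite; all nonzero
  entries lie in the block spanned by domain and range.\<close>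

lemma partial_translation_finite_matrices:
  assumes D: "finite (translation_domain n :: 'a::int_subset set)"
  shows "(partial_translation n :: 'a ell2 \<Rightarrow>\<^sub>L 'a ell2) \<in> finite_matrices"
proof -
  define R where "R = {y :: 'a. incl y - n \<in> range (incl :: 'a \<Rightarrow> int)}"
  have "incl ` R \<subseteq> (\<lambda>x. incl x + n) ` (translation_domain n :: 'a set)"
  proof clarify
    fix y assume "y \<in> R"
    then obtain x :: 'a where "incl y - n = incl x"
      by (auto simp: R_def)
    then have "incl y = incl x + n"
      by simp
    then show "incl y \<in> (\<lambda>x. incl x + n) ` (translation_domain n :: 'a set)"
      by (intro image_eqI[of _ _ x]) (auto simp: translation_domain_def intro: range_eqI[of _ _ y])
  qed
  then have R: "finite R"
    using D inj_incl by (meson finite_imageD finite_imageI finite_subset inj_on_subset subset_UNIV)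
  define F where "F = translation_domain n \<union> R"
  have F: "finite F"
    using D R by (simp add: F_def)
  have "coord_proj F o\<^sub>L partial_translation n o\<^sub>L coord_proj F = partial_translation n"
  proof (intro blinfun_eqI ell2_eqI)
    fix f :: "'a ell2" and y :: 'a
    show "ell2_apply (blinfun_apply (coord_proj F o\<^sub>L partial_translation n o\<^sub>L coord_proj F) f) y
        = ell2_apply (blinfun_apply (partial_translation n) f) y"
    proof (cases "y \<in> R")
      case True
      then obtain x :: 'a where "incl y - n = incl x"
        by (auto simp: R_def)
      then have x: "incl y = incl x + n"
        by simp
      then have "x \<in> F"
        by (auto simp: F_def translation_domain_def intro: range_eqI[of _ _ y])
      moreover have "y \<in> F"
        using True by (simp add: F_def)
      ultimately show ?thesis
        by (simp add: ell2_apply_coord_trunc F ell2_apply_partial_translation[OF x])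
    next
      case False
      then show ?thesis
        by (simp add: R_def ell2_apply_coord_trunc F ell2_apply_partial_translation_zero)
    qed
  qed
  then show ?thesis
    using F by (auto simp: finite_matrices_def partial_translation_bounded_ops)
qed

text \<open>The generated algebra is the intersection of all C*-subalgebras containing the
  translations, so membership is checked in each of them separately.\<close>

lemma partial_translation_algebraI:
  assumes "\<And>A. cstar_subalgebra A \<Longrightarrow> range partial_translation \<subseteq> A \<Longrightarrow> T \<in> A"
  shows "T \<in> partial_translation_algebra"
  using assms by (simp add: partial_translation_algebra_def cstar_generated_def hull_def)

lemma translation_support_in_algebra: "translation_support n \<in> partial_translation_algebra"
  unfolding translation_support_def
  by (rule partial_translation_algebraI) (auto simp: cstar_subalgebra_def image_subset_iff)

section \<open>The algebra of the primes\<close>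

lemma range_incl_prime_int: "range (incl :: prime_int \<Rightarrow> int) = {p. prime p}"
proof
  show "range (incl :: prime_int \<Rightarrow> int) \<subseteq> {p. prime p}"
    using int_of_prime by (auto simp: incl_prime_int_def)
  show "{p. prime p} \<subseteq> range (incl :: prime_int \<Rightarrow> int)"
  proof
    fix p :: int assume "p \<in> {p. prime p}"
    then show "p \<in> range (incl :: prime_int \<Rightarrow> int)"
      by (intro range_eqI[of _ _ "Abs_prime_int p"]) (simp add: incl_prime_int_def Abs_prime_int_inverse)
  qed
qed

lemma prime_incl [simp]: "prime (incl (x :: prime_int))"
  using range_incl_prime_int by blast

lemma translation_domain_prime_int: "translation_domain n = {x :: prime_int. prime (incl x + n)}"
  by (simp add: translation_domain_def range_incl_prime_int)

lemma even_prime_int: "prime (p :: int) \<Longrightarrow> even p \<Longrightarrow> p = 2"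
  using prime_ge_2_int[of p] prime_odd_int[of p] by force

text \<open>
  The only consecutive primes are 2 and 3, so the translation by 1 isolates the prime 2;
  every other matrix entry is obtained from that one by translating.
\<close>

lemma matrix_unit_eq_translations:
  fixes x y :: prime_int
  shows "matrix_unit x y
    = partial_translation (incl x - 2) o\<^sub>L translation_support 1 o\<^sub>L partial_translation (2 - incl y)"
proof (intro blinfun_eqI ell2_eqI)
  fix f :: "prime_int ell2" and w
  obtain two :: prime_int where two: "incl two = 2"
  proof -
    have "(2 :: int) \<in> range (incl :: prime_int \<Rightarrow> int)"
      by (simp add: range_incl_prime_int)
    with that show thesis
      by (metis rangeE)
  qed
  have dom: "z \<in> translation_domain 1 \<longleftrightarrow> z = two" for z
  proof
    assume "z \<in> translation_domain 1"
    then have "prime (incl z + 1)"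
      by (simp add: translation_domain_prime_int)
    moreover have "incl z \<ge> 2"
      by (simp add: prime_ge_2_int)
    ultimately have "even (incl z)"
      using even_prime_int[of "incl z + 1"] by auto
    then have "incl z = incl two"
      using even_prime_int[of "incl z"] two by simp
    then show "z = two"
      by (rule injD[OF inj_incl])
  qed (simp add: translation_domain_prime_int two)
  let ?g = "blinfun_apply (translation_support 1) (blinfun_apply (partial_translation (2 - incl y)) f)"
  have "ell2_apply (blinfun_apply (partial_translation (incl x - 2)) ?g) w = (if w = x then ell2_apply f y else 0)"
  proof (cases "w = x")
    case True
    have "ell2_apply (blinfun_apply (partial_translation (incl x - 2)) ?g) x = ell2_apply ?g two"
      by (rule ell2_apply_partial_translation) (simp add: two)
    also have "\<dots> = ell2_apply (blinfun_apply (partial_translation (2 - incl y)) f) two"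
      by (simp add: ell2_apply_translation_support dom)
    also have "\<dots> = ell2_apply f y"
      by (rule ell2_apply_partial_translation) (simp add: two)
    finally show ?thesis
      using True by simp
  next
    case False
    show ?thesis
    proof (cases "incl w - (incl x - 2) \<in> range (incl :: prime_int \<Rightarrow> int)")
      case True
      then obtain z :: prime_int where "incl w - (incl x - 2) = incl z"
        by auto
      then have z: "incl w = incl z + (incl x - 2)"
        by simp
      have "z \<noteq> two"
        using z two False injD[OF inj_incl, of w x] by auto
      then show ?thesis
        using False by (simp add: ell2_apply_partial_translation[OF z] ell2_apply_translation_support dom)
    qed (simp add: False ell2_apply_partial_translation_zero)
  qed
  then show "ell2_apply (blinfun_apply (matrix_unit x y) f) w
      = ell2_apply (blinfun_apply (partial_translation (incl x - 2) o\<^sub>L translation_support 1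
          o\<^sub>L partial_translation (2 - incl y)) f) w"
    by (simp add: scaleC.rep_eq delta.rep_eq)
qed

text \<open>The matrix units are products of translations and the identity is the translation by 0;
  linear combinations and norm limits give the rest.\<close>

lemma unitised_compacts_subset_prime_algebra: "unitised_compacts \<subseteq> prime_algebra"
proof
  fix T :: "prime_int ell2 \<Rightarrow>\<^sub>L prime_int ell2"
  assume T: "T \<in> unitised_compacts"
  show "T \<in> prime_algebra"
  proof (rule partial_translation_algebraI)
    fix A :: "(prime_int ell2 \<Rightarrow>\<^sub>L prime_int ell2) set"
    assume A: "cstar_subalgebra A" and t: "range partial_translation \<subseteq> A"
    have "matrix_unit x y \<in> A" for x y
      unfolding matrix_unit_eq_translations translation_support_def
      using A t by (auto simp: cstar_subalgebra_def image_subset_iff)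
    moreover have "id_blinfun \<in> A"
      using t partial_translation_zero by (metis range_subsetD)
    ultimately show "T \<in> A"
      using unitised_compacts_subset[OF A] T by blast
  qed
qed

text \<open>Otherwise every prime beyond some bound would stay prime after adding \<open>n\<close>,
  and iteration would give an infinite arithmetic progression of primes. This supplies the
  infinitely many eigenvectors with eigenvalue 0 of the support projection.\<close>

lemma infinite_not_prime_translate:
  assumes n: "n > 0"
  shows "infinite (- translation_domain n :: prime_int set)"
proof
  assume "finite (- translation_domain n :: prime_int set)"
  then obtain B where B: "\<And>x :: prime_int. \<not> prime (incl x + n) \<Longrightarrow> incl x \<le> B"
    using bdd_above_finite[OF finite_imageI, of "- translation_domain n :: prime_int set" incl]
    by (auto simp: translation_domain_prime_int bdd_above_def)
  obtain q :: nat where q: "prime q" "nat B < q"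
    using bigger_prime by blast
  define p where "p = int q"
  have p: "prime p" "p > B"
    using q by (simp_all add: p_def prime_int_nat_transfer)
  have "prime (p + int k * n)" for k
  proof (induction k)
    case (Suc k)
    then obtain x :: prime_int where x: "incl x = p + int k * n"
      using range_incl_prime_int by (metis mem_Collect_eq rangeE)
    have "int k * n \<ge> 0"
      using n by simp
    then have "prime (incl x + n)"
      using B[of x] x p(2) by linarith
    then show ?case
      by (simp add: x algebra_simps)
  qed (use p in simp)
  \<comment> \<open>At \<open>k = q\<close> the term of the progression is
    \<open>p * (1 + n)\<close>, a proper multiple of \<open>p\<close> since
    \<open>n > 0\<close>.\<close>
  from this[of q] have "prime (p * (1 + n))"
    by (simp add: p_def algebra_simps)
  then have "m = 1 \<or> m = p * (1 + n)" if "m \<ge> 0" "m dvd p * (1 + n)" for m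
    using that unfolding prime_int_iff by blast
  from this[of p] show False
    using prime_ge_2_int[OF p(1)] n by simp
qed

lemma infinite_prime_int: "infinite (UNIV :: prime_int set)"
  using infinite_not_prime_translate[of 1] by (meson infinite_super subset_UNIV zero_less_one)

section \<open>De Polignac pairs and domains of translations\<close>

lemma de_polignac_iff: "de_polignac n \<longleftrightarrow> infinite (translation_domain n :: prime_int set)"
proof -
  let ?h = "\<lambda>x :: prime_int. (incl x, incl x + n)"
  have "{(p, q). prime p \<and> prime q \<and> q - p = n} = ?h ` translation_domain n"
  proof (intro equalityI subrelI)
    fix p q :: int assume "(p, q) \<in> {(p, q). prime p \<and> prime q \<and> q - p = n}"
    then have pq: "prime p" "prime q" "q = p + n"
      by auto
    then obtain x :: prime_int where "incl x = p"
      using range_incl_prime_int by (metis mem_Collect_eq rangeE)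
    then show "(p, q) \<in> ?h ` translation_domain n"
      using pq by (intro image_eqI[of _ _ x]) (auto simp: translation_domain_prime_int)
  next
    fix p q :: int assume "(p, q) \<in> ?h ` translation_domain n"
    then show "(p, q) \<in> {(p, q). prime p \<and> prime q \<and> q - p = n}"
      by (auto simp: translation_domain_prime_int)
  qed
  moreover have "inj_on ?h (translation_domain n)"
    by (auto intro!: inj_onI injD[OF inj_incl])
  ultimately show ?thesis
    by (simp add: de_polignac_def finite_image_iff)
qed

text \<open>Exchanging the two primes of each pair reduces translations by negative numbers to
  positive distances.\<close>

lemma de_polignac_minus: "de_polignac (- n) = de_polignac n"
proof -
  have "{(p :: int, q :: int). prime p \<and> prime q \<and> q - p = - n}
      = prod.swap ` {(p, q). prime p \<and> prime q \<and> q - p = n}"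
    by (auto simp: image_iff)
  then show ?thesis
    by (simp add: de_polignac_def finite_image_iff)
qed

text \<open>With an odd difference one of the two primes is even and hence 2, which leaves at most
  two choices for the first prime.\<close>

lemma not_de_polignac_odd:
  assumes "odd n"
  shows "\<not> de_polignac n"
proof -
  have "translation_domain n \<subseteq> (incl -` {2, 2 - n} :: prime_int set)"
  proof
    fix x :: prime_int assume "x \<in> translation_domain n"
    then have "incl x = 2 \<or> incl x + n = 2"
      using assms even_prime_int[of "incl x"] even_prime_int[of "incl x + n"]
      by (auto simp: translation_domain_prime_int)
    then show "x \<in> incl -` {2, 2 - n}"
      by auto
  qed
  moreover have "finite (incl -` {2, 2 - n} :: prime_int set)"
    by (intro finite_vimageI inj_incl) simp
  ultimately show ?thesis
    unfolding de_polignac_iff by (simp add: finite_subset)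
qed

text \<open>Under this assumption every generator is the identity or a finite matrix, so the
  C*-algebra of unitised compacts contains the generated one.\<close>

lemma prime_algebra_eq_unitised_compacts:
  assumes "\<not> (\<exists>n > 0. even n \<and> de_polignac n)"
  shows "prime_algebra = unitised_compacts"
proof
  have "partial_translation n \<in> (unitised_compacts :: (prime_int ell2 \<Rightarrow>\<^sub>L prime_int ell2) set)" for n
  proof (cases "n = 0")
    case True
    have "id_blinfun = 0 + scalar_op 1"
      by (rule blinfun_eqI) simp
    then show ?thesis
      using True unitised_compactsI[OF zero_compact_ops, of 1] by (metis partial_translation_zero)
  next
    case False
    have "\<not> de_polignac n"
    proof (cases "odd n")
      case False
      then show ?thesis
        using assms \<open>n \<noteq> 0\<close> de_polignac_minus[of n]
        by (metis dvd_minus_iff linorder_neqE_linordered_idom neg_0_less_iff_less)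
    qed (rule not_de_polignac_odd)
    then show ?thesis
      by (simp add: de_polignac_iff partial_translation_finite_matrices finite_matrices_compact compact_ops_unitised)
  qed
  then show "prime_algebra \<subseteq> unitised_compacts"
    unfolding partial_translation_algebra_def cstar_generated_def
    by (intro hull_minimal cstar_subalgebra_unitised_compacts infinite_prime_int) auto
qed (rule unitised_compacts_subset_prime_algebra)

section \<open>Consequences of infinitely many pairs at one distance\<close>

lemma matrix_unit_prime_algebra: "matrix_unit x y \<in> prime_algebra"
  by (intro subsetD[OF unitised_compacts_subset_prime_algebra] compact_ops_unitised
      finite_matrices_compact matrix_unit_finite_matrices)

text \<open>The standard basis itself is an orthonormal eigenfamily, with eigenvalue 1 on the domain
  and 0 off it, and both index sets are infinite.\<close>

lemma translation_support_not_unitised: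
  assumes "n > 0" "de_polignac n"
  shows "translation_support n \<notin> (unitised_compacts :: (prime_int ell2 \<Rightarrow>\<^sub>L prime_int ell2) set)"
proof (rule not_unitised_compacts[where v = delta])
  show "infinite (translation_domain n :: prime_int set)"
    using assms de_polignac_iff by blast
  show "infinite (- translation_domain n :: prime_int set)"
    using assms by (intro infinite_not_prime_translate)
qed (auto intro!: ell2_eqI simp: cinner_delta_left delta.rep_eq ell2_apply_translation_support zero_ell2.rep_eq)

text \<open>An abstract isomorphism need not respect the basis vectors, so an orthonormal
  eigenfamily for the image of the support projection is rebuilt from its algebraic relations with
  the diagonal matrix units.\<close>

lemma prime_algebra_not_isomorphic:
  assumes n: "n > 0" "de_polignac n"
  shows "\<not> star_isomorphic prime_algebra
    (unitised_compacts :: (prime_int ell2 \<Rightarrow>\<^sub>L prime_int ell2) set)"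
proof
  let ?A = prime_algebra
  assume "star_isomorphic ?A (unitised_compacts :: (prime_int ell2 \<Rightarrow>\<^sub>L prime_int ell2) set)"
  then obtain \<phi> :: "(prime_int ell2 \<Rightarrow>\<^sub>L prime_int ell2) \<Rightarrow> prime_int ell2 \<Rightarrow>\<^sub>L prime_int ell2"
    where bij: "bij_betw \<phi> ?A unitised_compacts"
      and add: "\<And>S T. S \<in> ?A \<Longrightarrow> T \<in> ?A \<Longrightarrow> \<phi> (S + T) = \<phi> S + \<phi> T"
      and mult: "\<And>S T. S \<in> ?A \<Longrightarrow> T \<in> ?A \<Longrightarrow> \<phi> (S o\<^sub>L T) = \<phi> S o\<^sub>L \<phi> T"
      and star: "\<And>T. T \<in> ?A \<Longrightarrow> \<phi> (adj T) = adj (\<phi> T)"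
    unfolding star_isomorphic_def by auto
  define E where "E x = \<phi> (matrix_unit x x)" for x
  have zero: "0 \<in> ?A"
    by (intro subsetD[OF unitised_compacts_subset_prime_algebra] compact_ops_unitised zero_compact_ops)
  have \<phi>0: "\<phi> 0 = 0"
    using add[OF zero zero] by simp
  have E_mult: "E x o\<^sub>L E y = (if x = y then E x else 0)" for x y
  proof -
    have "matrix_unit x x o\<^sub>L matrix_unit y y = (if x = y then matrix_unit x x else 0)"
      by (rule blinfun_eqI) (simp add: scaleC.rep_eq delta.rep_eq)
    then show ?thesis
      unfolding E_def by (simp add: \<phi>0 flip: mult[OF matrix_unit_prime_algebra matrix_unit_prime_algebra])
  qed
  have E_bounded: "E x \<in> bounded_ops" for x
    using bij_betwE[OF bij] matrix_unit_prime_algebra unitised_compacts_bounded unfolding E_def by blast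
  have E_adj: "cinner (blinfun_apply (E x) f) g = cinner f (blinfun_apply (E x) g)" for x f g
    using cinner_adj[OF E_bounded, of x f g] star[OF matrix_unit_prime_algebra, of x x]
    by (simp add: E_def adj_matrix_unit)
  \<comment> \<open>Injectivity of \<open>\<phi>\<close> makes \<open>E x\<close> a nonzero
    idempotent; normalising a nonzero vector of its range gives a unit vector that it fixes.\<close>
  have "\<exists>v. norm v = 1 \<and> blinfun_apply (E x) v = v" for x
  proof -
    have "matrix_unit x x \<noteq> 0"
    proof
      assume "matrix_unit x x = 0"
      then have "blinfun_apply (matrix_unit x x) (delta x) = 0"
        by simp
      then have "delta x = 0"
        by (simp add: delta.rep_eq)
      then show False
        by (metis norm_delta norm_zero zero_neq_one)
    qed
    then have "E x \<noteq> 0"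
      using bij \<phi>0 zero matrix_unit_prime_algebra unfolding E_def bij_betw_def by (metis inj_onD)
    then obtain g where g: "blinfun_apply (E x) g \<noteq> 0"
      by (metis blinfun_eqI zero_blinfun.rep_eq)
    have "blinfun_apply (E x) (blinfun_apply (E x) g) = blinfun_apply (E x) g"
      using E_mult[of x x] by (metis blinfun_apply_blinfun_compose)
    with g show ?thesis
      by (intro exI[of _ "blinfun_apply (E x) g /\<^sub>R norm (blinfun_apply (E x) g)"])
        (simp add: blinfun.scaleR_right)
  qed
  then obtain v where v1: "\<And>x. norm (v x) = 1" and Ev: "\<And>x. blinfun_apply (E x) (v x) = v x"
    by metis
  \<comment> \<open>Self-adjointness moves \<open>E x\<close> to the other side of the inner
    product, where its product with \<open>E y\<close> vanishes.\<close>
  have orth: "cinner (v x) (v y) = 0" if "x \<noteq> y" for x y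
  proof -
    have "cinner (v x) (v y) = cinner (blinfun_apply (E x) (v x)) (blinfun_apply (E y) (v y))"
      by (simp add: Ev)
    also have "\<dots> = cinner (v x) (blinfun_apply (E x o\<^sub>L E y) (v y))"
      by (simp add: E_adj)
    finally show ?thesis
      using that by (simp add: E_mult)
  qed
  \<comment> \<open>Since \<open>E x\<close> fixes \<open>v x\<close>, the image under
    \<open>\<phi>\<close> of the relation with \<open>matrix_unit x x\<close> determines the value
    at \<open>v x\<close>.\<close>
  have supp: "blinfun_apply (\<phi> (translation_support n)) (v x)
      = (if x \<in> translation_domain n then v x else 0)" for x
  proof -
    have "\<phi> (translation_support n) o\<^sub>L E x = (if x \<in> translation_domain n then E x else 0)"
      unfolding E_def
      by (simp add: \<phi>0 translation_support_matrix_unit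
          flip: mult[OF translation_support_in_algebra matrix_unit_prime_algebra])
    then show ?thesis
      by (metis (full_types) Ev blinfun_apply_blinfun_compose zero_blinfun.rep_eq)
  qed
  have "\<phi> (translation_support n) \<notin> unitised_compacts"
    by (rule not_unitised_compacts[where v = v and I = "translation_domain n" and J = "- translation_domain n"])
      (use n v1 orth supp de_polignac_iff infinite_not_prime_translate in auto)
  then show False
    using bij_betwE[OF bij] translation_support_in_algebra by blast
qed

section \<open>Cosets modulo the compact operators\<close>

lemma compact_coset: "compact_ops +>\<^bsub>op_ring A\<^esub> T = (\<lambda>K. K + T) ` compact_ops"
  by (auto simp: a_r_coset_def r_coset_def op_ring_def)

lemma compact_coset_add_compact:
  assumes "K \<in> compact_ops"
  shows "compact_ops +>\<^bsub>op_ring A\<^esub> (K + T) = compact_ops +>\<^bsub>op_ring A\<^esub> T"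
proof -
  have "L + (K + T) \<in> (\<lambda>K. K + T) ` compact_ops" if "L \<in> compact_ops" for L
    using that assms by (intro image_eqI[of _ _ "L + K"]) (auto simp: add_compact_ops add.assoc)
  moreover have "L + T \<in> (\<lambda>L. L + (K + T)) ` compact_ops" if "L \<in> compact_ops" for L
    using that assms by (intro image_eqI[of _ _ "L - K"]) (auto simp: diff_compact_ops)
  ultimately show ?thesis
    unfolding compact_coset by blast
qed

lemma carrier_op_ring_Quot:
  "carrier (op_ring A Quot compact_ops) = {compact_ops +>\<^bsub>op_ring A\<^esub> T | T. T \<in> A}"
  by (auto simp: FactRing_def A_RCOSETS_def RCOSETS_def a_r_coset_def op_ring_def)

lemma quotient_scalars_subset:
  assumes "unitised_compacts \<subseteq> A"
  shows "quotient_scalars A \<subseteq> carrier (op_ring A Quot compact_ops)"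
proof -
  have "scalar_op c \<in> A" for c
    using assms unitised_compactsI[OF zero_compact_ops, of c] by auto
  then show ?thesis
    by (auto simp: quotient_scalars_def carrier_op_ring_Quot)
qed

text \<open>The coset of \<open>T\<close> is that of a scalar exactly when \<open>T\<close> is
  compact plus scalar, so the scalars fill the quotient exactly when \<open>A\<close> is no larger
  than the unitised compacts.\<close>

lemma quotient_scalars_psubset_iff:
  assumes "unitised_compacts \<subseteq> A"
  shows "quotient_scalars A \<subset> carrier (op_ring A Quot compact_ops) \<longleftrightarrow> A \<noteq> unitised_compacts"
proof -
  have "compact_ops +>\<^bsub>op_ring A\<^esub> T \<in> quotient_scalars A \<longleftrightarrow> T \<in> unitised_compacts" for T
  proof
    assume "compact_ops +>\<^bsub>op_ring A\<^esub> T \<in> quotient_scalars A"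
    then obtain c where "(\<lambda>K. K + T) ` compact_ops = (\<lambda>K. K + scalar_op c) ` compact_ops"
      by (auto simp: quotient_scalars_def compact_coset)
    moreover have "T \<in> (\<lambda>K. K + T) ` compact_ops"
      by (intro image_eqI[of _ _ 0]) (simp_all add: zero_compact_ops)
    ultimately show "T \<in> unitised_compacts"
      by (auto intro: unitised_compactsI)
  next
    assume "T \<in> unitised_compacts"
    then show "compact_ops +>\<^bsub>op_ring A\<^esub> T \<in> quotient_scalars A"
      by (auto simp: unitised_compacts_def compact_coset_add_compact quotient_scalars_def)
  qed
  then have "carrier (op_ring A Quot compact_ops) \<subseteq> quotient_scalars A \<longleftrightarrow> A \<subseteq> unitised_compacts"
    by (auto simp: carrier_op_ring_Quot)
  then show ?thesis
    using quotient_scalars_subset[OF assms] assms by blast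
qed

lemma star_isomorphic_refl: "star_isomorphic A A"
  unfolding star_isomorphic_def by (rule exI[of _ "\<lambda>T. T"]) (auto simp: bij_betw_def)

theorem theorem3:
  shows "(\<not> star_isomorphic prime_algebra
              (unitised_compacts :: (prime_int ell2 \<Rightarrow>\<^sub>L prime_int ell2) set)
            \<longleftrightarrow> (\<exists>n > 0. even n \<and> de_polignac n))
       \<and> ((\<exists>n > 0. even n \<and> de_polignac n)
            \<longleftrightarrow> quotient_scalars prime_algebra
                  \<subset> carrier (op_ring prime_algebra Quot compact_ops))"
proof (cases "\<exists>n > 0. even n \<and> de_polignac n")
  \<comment> \<open>Here all three conditions hold: one support projection lies outside the unitised
    compacts, and no isomorphism exists.\<close>
  case True
  then obtain n where n: "n > 0" "de_polignac n"
    by blast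
  then have "prime_algebra \<noteq> (unitised_compacts :: (prime_int ell2 \<Rightarrow>\<^sub>L prime_int ell2) set)"
    using translation_support_in_algebra translation_support_not_unitised by blast
  with True n show ?thesis
    by (simp add: prime_algebra_not_isomorphic
        quotient_scalars_psubset_iff[OF unitised_compacts_subset_prime_algebra])
next
  \<comment> \<open>Here all three conditions fail, because the two algebras coincide.\<close>
  case False
  then show ?thesis
    by (simp add: prime_algebra_eq_unitised_compacts star_isomorphic_refl quotient_scalars_psubset_iff)
qed

end
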